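(* Let $(G,\tau)$ be an abelian topological group whose group $G^\wedge$ of continuous characters separates the points of $G$ (i.e. $(G,\tau)$ is MAP). The following assertions are equivalent: (1) There exists a $g$-barrelled group topology $\mu$ on $G$ compatible with the duality $(G,G^\wedge)$, i.e. with $(G,\mu)^\wedge=G^\wedge$. (2) The topological group $(G^\wedge,\sigma(G^\wedge,G))$ is semireflexive. (3) The topology $\tau_{\mathcal K}$ on $G$ is compatible with $\tau$, i.e. $(G,\tau_{\mathcal K})^\wedge=G^\wedge$.
   Context: All groups are abelian. $\mathbb T$ is the unit circle in $\mathbb C$ and $\mathbb T_+=\{e^{2\pi i t}: t\in[-1/4,1/4]\}$. A character of $G$ is a homomorphism $G\to\mathbb T$; for a topological group $(G,\tau)$, $G^\wedge=(G,\tau)^\wedge$ is the group of continuous characters under pointwise operations. Two group topologies on $G$ are compatible if they have the same group of continuous characters. $\sigma(G^\wedge,G)$ is the topology of pointwise convergence on $G^\wedge$. For $A\subseteq G$, $A^\triangleright=\{\chi\in G^\wedge:\chi(x)\in\mathbb T_+\ \forall x\in A\}$; for $B\subseteq G^\wedge$, $B^\triangleleft=\{x\in G:\chi(x)\in\mathbb T_+\ \forall\chi\in B\}$. A set $S\subseteq G^\wedge$ is equicontinuous with respect to $\tau$ if $S\subseteq U^\triangleright$ for some $\tau$-neighborhood $U$ of zero. A topological group $(G,\mu)$ is $g$-barrelled if, writing $H=(G,\mu)^\wedge$, every $\sigma(H,G)$-compact subset of $H$ is equicontinuous with respect to $\mu$ (local quasi-convexity is not required). $\mathcal K$ is the family of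 all $\sigma(G^\wedge,G)$-compact subsets of $G^\wedge$, and $\tau_{\mathcal K}$ is the topology on $G$ of uniform convergence on the members of $\mathcal K$; the sets $K^\triangleleft$, $K\in\mathcal K$, form a basis of neighborhoods of zero for $\tau_{\mathcal K}$. For a topological group $X$, its Pontryagin dual is $X^\wedge$ with the compact-open topology, and $X^{\wedge\wedge}$ is the Pontryagin dual of the Pontryagin dual. $X$ is semireflexive (in Pontryagin's sense) if the canonical evaluation map $X\to X^{\wedge\wedge}$, $x\mapsto(\chi\mapsto\chi(x))$, is surjective (for $X=(G^\wedge,\sigma(G^\wedge,G))$ this map is automatically injective). *)

theory Defs
  imports "HOL-Analysis.Analysis" "HOL-Algebra.Group"
begin

text \<open>
  Groups are carrier-based, since the same group carries several topologies and duals have to be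
  iterated.  They are written multiplicatively, so the neutral element ("zero") of \<open>G\<close> is
  \<open>\<one>\<^bsub>G\<^esub>\<close>.  Group topologies are not required to be Hausdorff.
\<close>

locale abelian_topological_group = comm_group G
  for G :: "('a, 'b) monoid_scheme" (structure) and T :: "'a topology" +
  assumes topspace_eq: "topspace T = carrier G"
    and continuous_mult: "continuous_map (prod_topology T T) T (\<lambda>(x, y). x \<otimes> y)"
    and continuous_inv: "continuous_map T T (\<lambda>x. inv x)"

definition circle_group :: "complex monoid" where
  "circle_group = \<lparr>carrier = sphere 0 1, monoid.mult = (*), one = 1\<rparr>"

definition circle_topology :: "complex topology" where
  "circle_topology = top_of_set (sphere 0 1)"

definition circle_plus :: "complex set" where
  "circle_plus = {exp (2 * of_real pi * \<i> * of_real t) | t::real. -1/4 \<le> t \<and> t \<le> 1/4}"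

text \<open>
  Characters are taken extensional (\<open>undefined\<close> outside the carrier), so that equality of
  characters is equality on the group.
\<close>

definition continuous_chars :: "('a, 'b) monoid_scheme \<Rightarrow> 'a topology \<Rightarrow> ('a \<Rightarrow> complex) set" where
  "continuous_chars G T =
    {\<phi> \<in> hom G circle_group \<inter> extensional (carrier G). continuous_map T circle_topology \<phi>}"

definition dual_group :: "('a, 'b) monoid_scheme \<Rightarrow> 'a topology \<Rightarrow> ('a \<Rightarrow> complex) monoid" where
  "dual_group G T =
    \<lparr>carrier = continuous_chars G T,
     monoid.mult = (\<lambda>\<phi> \<psi>. \<lambda>x\<in>carrier G. \<phi> x * \<psi> x),
     one = (\<lambda>x\<in>carrier G. 1)\<rparr>"

definition separates_points :: "('a, 'b) monoid_scheme \<Rightarrow> ('a \<Rightarrow> complex) set \<Rightarrow> bool" where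
  "separates_points G H \<longleftrightarrow> (\<forall>x\<in>carrier G. \<forall>y\<in>carrier G. x \<noteq> y \<longrightarrow> (\<exists>\<phi>\<in>H. \<phi> x \<noteq> \<phi> y))"

text \<open>The topology \<open>\<sigma>(G\<^sup>\<and>, G)\<close>.\<close>

definition pointwise_topology ::
    "('a, 'b) monoid_scheme \<Rightarrow> 'a topology \<Rightarrow> ('a \<Rightarrow> complex) topology" where
  "pointwise_topology G T =
    subtopology (product_topology (\<lambda>_. circle_topology) (carrier G)) (continuous_chars G T)"

definition polar :: "('a, 'b) monoid_scheme \<Rightarrow> 'a topology \<Rightarrow> 'a set \<Rightarrow> ('a \<Rightarrow> complex) set" where
  "polar G T A = {\<phi> \<in> continuous_chars G T. \<forall>x\<in>A. \<phi> x \<in> circle_plus}"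

definition equicontinuous_chars ::
    "('a, 'b) monoid_scheme \<Rightarrow> 'a topology \<Rightarrow> ('a \<Rightarrow> complex) set \<Rightarrow> bool" where
  "equicontinuous_chars G T S \<longleftrightarrow>
    (\<exists>U \<subseteq> carrier G. (\<exists>V. openin T V \<and> \<one>\<^bsub>G\<^esub> \<in> V \<and> V \<subseteq> U) \<and> S \<subseteq> polar G T U)"

definition g_barrelled :: "('a, 'b) monoid_scheme \<Rightarrow> 'a topology \<Rightarrow> bool" where
  "g_barrelled G T \<longleftrightarrow>
    (\<forall>S. compactin (pointwise_topology G T) S \<longrightarrow> equicontinuous_chars G T S)"

text \<open>
  The topology on \<open>G\<close> of uniform convergence on the members of a family \<open>\<K>\<close> of sets of
  circle-valued functions.  Finite subfamilies make this a topology for every \<open>\<K>\<close>; for a family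
  closed under finite unions, single members would do.
\<close>

definition uniform_nbhd ::
    "('a, 'b) monoid_scheme \<Rightarrow> ('a \<Rightarrow> complex) set set \<Rightarrow> real \<Rightarrow> 'a \<Rightarrow> 'a set" where
  "uniform_nbhd G \<F> \<epsilon> x = {y \<in> carrier G. \<forall>K\<in>\<F>. \<forall>\<phi>\<in>K. dist (\<phi> y) (\<phi> x) < \<epsilon>}"

definition uniform_convergence_topology ::
    "('a, 'b) monoid_scheme \<Rightarrow> ('a \<Rightarrow> complex) set set \<Rightarrow> 'a topology" where
  "uniform_convergence_topology G \<K> =
    topology (\<lambda>U. U \<subseteq> carrier G \<and>
      (\<forall>x\<in>U. \<exists>\<F> \<epsilon>. finite \<F> \<and> \<F> \<subseteq> \<K> \<and> 0 < \<epsilon> \<and> uniform_nbhd G \<F> \<epsilon> x \<subseteq> U))"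

lemma openin_uniform_convergence_topology:
  "openin (uniform_convergence_topology G \<K>) U \<longleftrightarrow>
    U \<subseteq> carrier G \<and>
    (\<forall>x\<in>U. \<exists>\<F> \<epsilon>. finite \<F> \<and> \<F> \<subseteq> \<K> \<and> 0 < \<epsilon> \<and> uniform_nbhd G \<F> \<epsilon> x \<subseteq> U)"
proof -
  let ?P = "\<lambda>U. U \<subseteq> carrier G \<and>
      (\<forall>x\<in>U. \<exists>\<F> \<epsilon>. finite \<F> \<and> \<F> \<subseteq> \<K> \<and> 0 < \<epsilon> \<and> uniform_nbhd G \<F> \<epsilon> x \<subseteq> U)"
  have inter: "?P (U \<inter> V)" if U: "?P U" and V: "?P V" for U V
  proof (intro conjI ballI)
    show "U \<inter> V \<subseteq> carrier G" using U by blast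
    fix x assume x: "x \<in> U \<inter> V"
    obtain \<F> e where F: "finite \<F>" "\<F> \<subseteq> \<K>" "0 < e" "uniform_nbhd G \<F> e x \<subseteq> U"
      using U x by blast
    obtain \<G> d where D: "finite \<G>" "\<G> \<subseteq> \<K>" "0 < d" "uniform_nbhd G \<G> d x \<subseteq> V"
      using V x by blast
    have "uniform_nbhd G (\<F> \<union> \<G>) (min e d) x \<subseteq> uniform_nbhd G \<F> e x \<inter> uniform_nbhd G \<G> d x"
      unfolding uniform_nbhd_def by auto
    then show "\<exists>\<F> \<epsilon>. finite \<F> \<and> \<F> \<subseteq> \<K> \<and> 0 < \<epsilon> \<and> uniform_nbhd G \<F> \<epsilon> x \<subseteq> U \<inter> V"
      using F D by (intro exI[of _ "\<F> \<union> \<G>"] exI[of _ "min e d"]) auto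
  qed
  have union: "?P (\<Union>\<U>)" if "\<forall>U\<in>\<U>. ?P U" for \<U>
  proof (intro conjI ballI)
    show "\<Union>\<U> \<subseteq> carrier G" using that by blast
    fix x assume "x \<in> \<Union>\<U>"
    then obtain U where U: "U \<in> \<U>" "x \<in> U" by blast
    have "?P U" using bspec[OF that U(1)] .
    then have "\<exists>\<F> \<epsilon>. finite \<F> \<and> \<F> \<subseteq> \<K> \<and> 0 < \<epsilon> \<and> uniform_nbhd G \<F> \<epsilon> x \<subseteq> U"
      using U(2) by (elim conjE bspec)
    then obtain \<F> e where "finite \<F>" "\<F> \<subseteq> \<K>" "0 < e" "uniform_nbhd G \<F> e x \<subseteq> U"
      by (elim exE conjE)
    with U show "\<exists>\<F> \<epsilon>. finite \<F> \<and> \<F> \<subseteq> \<K> \<and> 0 < \<epsilon> \<and> uniform_nbhd G \<F> \<epsilon> x \<subseteq> \<Union>\<U>"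
      by (intro exI[of _ \<F>] exI[of _ e]) auto
  qed
  have "istopology ?P"
    unfolding istopology_def
    by (rule conjI; intro allI impI) (rule inter union; assumption)+
  then show ?thesis
    unfolding uniform_convergence_topology_def by (rule topology_inverse'[THEN fun_cong])
qed

lemma topspace_uniform_convergence_topology [simp]:
  "topspace (uniform_convergence_topology G \<K>) = carrier G"
proof -
  have "openin (uniform_convergence_topology G \<K>) (carrier G)"
    unfolding openin_uniform_convergence_topology
    by (auto simp: uniform_nbhd_def intro!: exI[of _ "{}"] exI[of _ "1::real"])
  moreover have "topspace (uniform_convergence_topology G \<K>) \<subseteq> carrier G"
    using openin_uniform_convergence_topology[THEN iffD1, OF openin_topspace] by (rule conjunct1)
  ultimately show ?thesis
    by (intro subset_antisym openin_subset)
qed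

text \<open>The topology \<open>\<tau>\<^sub>\<K>\<close>, for \<open>\<K>\<close> the family of all \<open>\<sigma>(G\<^sup>\<and>, G)\<close>-compact sets.\<close>

definition tau_K :: "('a, 'b) monoid_scheme \<Rightarrow> 'a topology \<Rightarrow> 'a topology" where
  "tau_K G T = uniform_convergence_topology G {K. compactin (pointwise_topology G T) K}"

text \<open>Pontryagin duality: \<open>dual_group G T\<close> with the compact-open topology.\<close>

definition compact_open_topology ::
    "('a, 'b) monoid_scheme \<Rightarrow> 'a topology \<Rightarrow> ('a \<Rightarrow> complex) topology" where
  "compact_open_topology G T =
    topology_generated_by
      {{\<phi> \<in> continuous_chars G T. \<phi> ` K \<subseteq> W} | K W. compactin T K \<and> openin circle_topology W}"

lemma topspace_compact_open_topology [simp]: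
  "topspace (compact_open_topology G T) = continuous_chars G T"
proof -
  have "continuous_chars G T \<in>
      {{\<phi> \<in> continuous_chars G T. \<phi> ` K \<subseteq> W} | K W. compactin T K \<and> openin circle_topology W}"
    by (intro CollectI exI[of _ "{}"]) auto
  then show ?thesis
    unfolding compact_open_topology_def topology_generated_by_topspace
    by (intro subset_antisym Union_upper) auto
qed

lemma topspace_pointwise_topology [simp]:
  "topspace (pointwise_topology G T) = continuous_chars G T"
  by (auto simp: pointwise_topology_def continuous_chars_def circle_topology_def circle_group_def
      hom_def PiE_def)

definition eval_char ::
    "('a, 'b) monoid_scheme \<Rightarrow> 'a topology \<Rightarrow> 'a \<Rightarrow> (('a \<Rightarrow> complex) \<Rightarrow> complex)" where
  "eval_char G T x = (\<lambda>\<phi>\<in>continuous_chars G T. \<phi> x)"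

definition semireflexive :: "('a, 'b) monoid_scheme \<Rightarrow> 'a topology \<Rightarrow> bool" where
  "semireflexive G T \<longleftrightarrow>
    eval_char G T ` carrier G = continuous_chars (dual_group G T) (compact_open_topology G T)"

end

(*
  The central fact is the theorem of Comfort and Ross that every character of (G^, sigma(G^, G)) is
  the evaluation at a point of G.  Granted this, evaluation is an isomorphism of G with that dual,
  and by a covering argument a homeomorphism from tau_K to the compact-open topology.  Hence
  semireflexivity says precisely that tau_K has no continuous characters besides those in G^.
  If mu is g-barrelled and compatible, all sigma-compact sets are mu-equicontinuous, so tau_K is
  coarser than mu and cannot have more characters; conversely tau_K, if compatible, is itself
  g-barrelled.
*)

theory Submission
  imports Defs "HOL-Real_Asymp.Real_Asymp"
begin

text \<open>In the Comfort-Ross theorem a \<sigma>-neighbourhood constrains only finitely many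
  evaluations, so the core is a statement about abstract groups: a character that is near 1 wherever
  finitely many others are near 1 is a product of integer powers of these. Classically one extends
  the character from a subgroup of a torus to the torus, whose dual is Z^n. Here invariant
  integration is replaced by averages over finite lists of group elements: they can be made small
  simultaneously for finitely many nontrivial characters, which is the orthogonality needed for
  trigonometric polynomials.

  A second obstacle is that equicontinuity is stated through the single coarse arc T_+, whereas
  \<open>tau_K\<close> is defined by arbitrarily small \<epsilon>. Repeated squaring converts one
  into the other.

  Finally, \<sigma>, its compact sets and \<open>tau_K\<close> are determined by the group of
  characters alone, so they agree for all compatible topologies.\<close>

lemma circle_charD:
  assumes "\<phi> \<in> hom G circle_group"
  shows circle_char_mult: "\<lbrakk>x \<in> carrier G; y \<in> carrier G\<rbrakk> \<Longrightarrow> \<phi> (x \<otimes>\<^bsub>G\<^esub> y) = \<phi> x * \<phi> y"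
    and circle_char_norm: "x \<in> carrier G \<Longrightarrow> cmod (\<phi> x) = 1"
  using assms by (auto simp: hom_def circle_group_def)

lemma circle_char_closed:
  "\<lbrakk>\<phi> \<in> hom G circle_group; x \<in> carrier G\<rbrakk> \<Longrightarrow> \<phi> x \<in> sphere 0 1"
  by (simp add: circle_char_norm)

lemma (in group) circle_char_one: "\<phi> \<in> hom G circle_group \<Longrightarrow> \<phi> \<one> = 1"
  using circle_char_mult[of \<phi> G \<one> \<one>] circle_char_norm[of \<phi> G \<one>] by auto

lemma (in group) circle_char_inv:
  assumes "\<phi> \<in> hom G circle_group" "x \<in> carrier G"
  shows "\<phi> (inv x) = cnj (\<phi> x)"
proof -
  have "\<phi> (inv x) * \<phi> x = 1"
    using circle_char_mult[OF assms(1), of "inv x" x] circle_char_one[OF assms(1)] assms(2) by simp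
  moreover have "cnj (\<phi> x) * \<phi> x = 1"
    using circle_char_norm[OF assms] by (simp add: mult.commute[of "cnj _"] complex_norm_square[symmetric])
  ultimately show ?thesis
    by (metis mult_right_cancel mult_zero_right zero_neq_one)
qed

lemma (in group) circle_char_pow:
  assumes "\<phi> \<in> hom G circle_group" "x \<in> carrier G"
  shows "\<phi> (x [^] (n::nat)) = \<phi> x ^ n"
  by (induction n) (simp_all add: circle_char_one circle_char_mult[OF assms(1)] assms mult.commute)

lemma circle_char_times:
  assumes "\<phi> \<in> hom G circle_group" "\<psi> \<in> hom G circle_group"
  shows "(\<lambda>x. \<phi> x * \<psi> x) \<in> hom G circle_group"
  using assms by (auto simp: hom_def circle_group_def norm_mult Pi_iff)

lemma circle_char_cnj:
  assumes "\<phi> \<in> hom G circle_group"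
  shows "(\<lambda>x. cnj (\<phi> x)) \<in> hom G circle_group"
  using assms by (auto simp: hom_def circle_group_def)

text \<open>Over an infinite \<open>X\<close> the product is 1 by convention, which is again a
  homomorphism, so finiteness of \<open>X\<close> is not among the hypotheses.\<close>

lemma circle_char_monomial:
  assumes "X \<subseteq> hom G circle_group"
  shows "(\<lambda>x. \<Prod>\<phi>\<in>X. \<phi> x ^ k \<phi>) \<in> hom G circle_group"
proof (cases "finite X")
  case True
  then show ?thesis using assms
  proof (induction X)
    case (insert \<phi> X)
    then show ?case
      by (auto simp: hom_def circle_group_def norm_mult norm_power power_mult_distrib Pi_iff)
  qed (auto simp: hom_def circle_group_def)
qed (auto simp: hom_def circle_group_def)


section \<open>Averages of characters over finite lists\<close>

text \<open>A finite substitute for an invariant mean. Lists rather than sets, because the powers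
  and products of group elements that are averaged over may coincide and must be counted with
  multiplicity.\<close>

definition list_avg :: "'a list \<Rightarrow> ('a \<Rightarrow> complex) \<Rightarrow> complex" where
  "list_avg hs f = (\<Sum>h\<leftarrow>hs. f h) / of_nat (length hs)"

lemma list_avg_sum_scaled:
  "list_avg hs (\<lambda>h. \<Sum>i\<in>I. c i * f i h) = (\<Sum>i\<in>I. c i * list_avg hs (f i))"
proof -
  have "(\<Sum>h\<leftarrow>hs. \<Sum>i\<in>I. c i * f i h) = (\<Sum>i\<in>I. c i * (\<Sum>h\<leftarrow>hs. f i h))"
    by (induction hs) (simp_all add: sum.distrib algebra_simps)
  then show ?thesis by (simp add: list_avg_def sum_divide_distrib)
qed

lemma list_avg_const: "hs \<noteq> [] \<Longrightarrow> (\<And>h. h \<in> set hs \<Longrightarrow> f h = c) \<Longrightarrow> list_avg hs f = c"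
proof -
  assume "hs \<noteq> []" and *: "\<And>h. h \<in> set hs \<Longrightarrow> f h = c"
  from * have "map f hs = replicate (length hs) c"
    by (induction hs) auto
  then show ?thesis using \<open>hs \<noteq> []\<close> by (simp add: list_avg_def sum_list_replicate)
qed

lemma norm_list_avg_le_1:
  assumes "\<And>h. h \<in> set hs \<Longrightarrow> cmod (f h) \<le> 1"
  shows "cmod (list_avg hs f) \<le> 1"
proof -
  from assms have "cmod (\<Sum>h\<leftarrow>hs. f h) \<le> length hs"
  proof (induction hs)
    case (Cons a hs)
    then show ?case
      by (simp, intro order_trans[OF norm_triangle_ineq]) (simp add: add_mono)
  qed simp
  then show ?thesis by (cases "hs = []") (simp_all add: list_avg_def norm_divide)
qed

lemma Re_list_avg_mono:
  assumes "\<And>h. h \<in> set hs \<Longrightarrow> Re (f h) \<le> Re (g h)"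
  shows "Re (list_avg hs f) \<le> Re (list_avg hs g)"
proof -
  from assms have "Re (\<Sum>h\<leftarrow>hs. f h) \<le> Re (\<Sum>h\<leftarrow>hs. g h)"
    by (induction hs) (auto simp: add_mono)
  then show ?thesis by (simp add: list_avg_def divide_right_mono)
qed

text \<open>The average over all products is a convolution of two averages, and a multiplicative
  \<open>f\<close> turns convolution into multiplication. This allows characters to be averaged away
  one after the other.\<close>

lemma list_avg_product:
  assumes "\<And>h k. h \<in> set hs \<Longrightarrow> k \<in> set ks \<Longrightarrow> f (m h k) = f h * f k"
  shows "list_avg (map (\<lambda>(h, k). m h k) (List.product hs ks)) f = list_avg hs f * list_avg ks f"
proof -
  have "(\<Sum>k\<leftarrow>ks. f (m h k)) = f h * (\<Sum>k\<leftarrow>ks. f k)" if "h \<in> set hs" for h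
    using assms[OF that] by (induction ks) (auto simp: algebra_simps)
  then have "(\<Sum>x\<leftarrow>map (\<lambda>(h, k). m h k) (List.product hs ks). f x) = (\<Sum>h\<leftarrow>hs. f h) * (\<Sum>k\<leftarrow>ks. f k)"
    by (induction hs) (auto simp: algebra_simps comp_def)
  then show ?thesis by (simp add: list_avg_def)
qed

text \<open>Averaging over 1, h, ..., h^(n-1) gives a geometric sum, bounded by 2 / |\<psi> h - 1|
  independently of n; dividing by a large n makes it small.\<close>

lemma (in group) exists_small_avg_single:
  assumes \<psi>: "\<psi> \<in> hom G circle_group" and h: "h \<in> carrier G" "\<psi> h \<noteq> 1" and \<epsilon>: "\<epsilon> > 0"
  shows "\<exists>hs. hs \<noteq> [] \<and> set hs \<subseteq> carrier G \<and> cmod (list_avg hs \<psi>) \<le> \<epsilon>"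
proof -
  have pos: "cmod (\<psi> h - 1) > 0" using h by simp
  obtain n :: nat where n: "2 / (\<epsilon> * cmod (\<psi> h - 1)) < n"
    using reals_Archimedean2 by blast
  have n0: "0 < real n"
    using n pos \<epsilon> by (meson divide_nonneg_pos less_le_trans mult_pos_pos not_le order_less_imp_le zero_le_numeral)
  define hs where "hs = map (\<lambda>i. h [^] i) [0..<n]"
  have "(\<Sum>x\<leftarrow>hs. \<psi> x) = (\<Sum>i<n. \<psi> h ^ i)"
    by (simp add: hs_def comp_def circle_char_pow[OF \<psi> h(1)] interv_sum_list_conv_sum_set_nat
        atLeast0LessThan)
  also have "\<dots> = (\<psi> h ^ n - 1) / (\<psi> h - 1)"
    using h(2) by (rule geometric_sum)
  finally have "cmod (\<Sum>x\<leftarrow>hs. \<psi> x) = cmod (\<psi> h ^ n - 1) / cmod (\<psi> h - 1)"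
    by (simp add: norm_divide)
  also have "\<dots> \<le> 2 / cmod (\<psi> h - 1)"
    using norm_triangle_ineq4[of "\<psi> h ^ n" 1] circle_char_norm[OF \<psi> h(1)]
    by (intro divide_right_mono) (auto simp: norm_power)
  also have "\<dots> \<le> \<epsilon> * n"
    using n pos \<epsilon> by (simp add: field_simps)
  finally have "cmod (list_avg hs \<psi>) \<le> \<epsilon>"
    using n0 by (simp add: list_avg_def norm_divide hs_def field_simps)
  moreover have "hs \<noteq> []" "set hs \<subseteq> carrier G"
    using n0 h by (auto simp: hs_def)
  ultimately show ?thesis by blast
qed

text \<open>In the inductive step the list for \<open>\<Psi>\<close> is multiplied by a list for the
  new character. Each average then becomes a product in which one factor is at most \<epsilon> and
  the other at most 1, so nothing gained earlier is lost.\<close>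

lemma (in group) exists_small_avg:
  assumes "finite \<Psi>" "\<Psi> \<subseteq> hom G circle_group" "\<And>\<psi>. \<psi> \<in> \<Psi> \<Longrightarrow> \<exists>h\<in>carrier G. \<psi> h \<noteq> 1" and \<epsilon>: "\<epsilon> > 0"
  shows "\<exists>hs. hs \<noteq> [] \<and> set hs \<subseteq> carrier G \<and> (\<forall>\<psi>\<in>\<Psi>. cmod (list_avg hs \<psi>) \<le> \<epsilon>)"
  using assms(1-3)
proof (induction \<Psi>)
  case empty
  then show ?case by (intro exI[of _ "[\<one>]"]) auto
next
  case (insert \<psi> \<Psi>)
  obtain hs where hs: "hs \<noteq> []" "set hs \<subseteq> carrier G" "\<forall>\<psi>\<in>\<Psi>. cmod (list_avg hs \<psi>) \<le> \<epsilon>"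
    using insert by auto
  obtain ks where ks: "ks \<noteq> []" "set ks \<subseteq> carrier G" "cmod (list_avg ks \<psi>) \<le> \<epsilon>"
    using exists_small_avg_single[of \<psi> _ \<epsilon>] insert.prems \<epsilon> by (meson insertI1 insert_subset)
  let ?hs = "map (\<lambda>(h, k). h \<otimes> k) (List.product hs ks)"
  have prod: "list_avg ?hs \<phi> = list_avg hs \<phi> * list_avg ks \<phi>" if "\<phi> \<in> insert \<psi> \<Psi>" for \<phi>
    using that insert.prems hs(2) ks(2)
    by (intro list_avg_product circle_char_mult) auto
  have le1: "cmod (list_avg hs \<phi>) \<le> 1" "cmod (list_avg ks \<phi>) \<le> 1" if "\<phi> \<in> insert \<psi> \<Psi>" for \<phi>
  proof -
    have "\<phi> \<in> hom G circle_group" using that insert.prems by blast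
    then show "cmod (list_avg hs \<phi>) \<le> 1" "cmod (list_avg ks \<phi>) \<le> 1"
      using hs(2) ks(2) by (auto intro!: norm_list_avg_le_1 simp: circle_char_norm subset_iff)
  qed
  have "cmod (list_avg ?hs \<phi>) \<le> \<epsilon>" if "\<phi> \<in> insert \<psi> \<Psi>" for \<phi>
  proof (cases "\<phi> = \<psi>")
    case True
    then show ?thesis
      using prod[OF that] le1[OF that] ks(3) mult_mono[OF le1(1)[OF that] ks(3)] by (simp add: norm_mult)
  next
    case False
    then have "cmod (list_avg hs \<phi>) \<le> \<epsilon>" using hs(3) that by blast
    then show ?thesis
      using prod[OF that] mult_mono[OF _ le1(2)[OF that], of _ \<epsilon>] \<epsilon> by (simp add: norm_mult)
  qed
  moreover have "?hs \<noteq> []"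
    using hs(1) ks(1) by (metis length_0_conv length_map length_product mult_is_0)
  moreover have "set ?hs \<subseteq> carrier G" using hs(2) ks(2) by auto
  ultimately show ?case by blast
qed


section \<open>Characters determined near the identity by finitely many characters\<close>

text \<open>The powers of (1 + z) / 2 serve as a peaking kernel: their coefficients are nonnegative
  and, taking all z equal to 1, sum to 1. Extensional exponent functions make the index set finite,
  with (M + 1)^|X| elements.\<close>

lemma binomial_mean_expansion:
  fixes z :: "'b \<Rightarrow> complex"
  assumes "finite X"
  shows "(\<Prod>x\<in>X. ((1 + z x) / 2) ^ M) =
    (\<Sum>k\<in>X \<rightarrow>\<^sub>E {..M}. of_real (\<Prod>x\<in>X. real (M choose k x) / 2 ^ M) * (\<Prod>x\<in>X. z x ^ k x))"
proof -
  have "((1 + w) / 2) ^ M = (\<Sum>j\<le>M. of_real (real (M choose j) / 2 ^ M) * w ^ j)" for w :: complex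
    using binomial_ring[of w 1 M] by (simp add: power_divide sum_divide_distrib add.commute)
  then show ?thesis
    using assms by (simp add: prod_sum_PiE prod.distrib[symmetric])
qed

text \<open>By the parallelogram law |1 + z|^2 + |z - 1|^2 = 4, so moving away from 1 shortens the
  mean of z and 1.\<close>

lemma norm_mean_circle_le:
  assumes "cmod z = 1" "0 \<le> d" "d \<le> dist z 1"
  shows "(cmod ((1 + z) / 2))\<^sup>2 \<le> 1 - d\<^sup>2 / 4"
proof -
  have "(cmod (1 + z))\<^sup>2 + (cmod (z - 1))\<^sup>2 = 4"
    using assms(1) unfolding cmod_power2 by (simp add: cmod_def power2_eq_square algebra_simps)
  moreover have "d\<^sup>2 \<le> (cmod (z - 1))\<^sup>2"
    using assms(2,3) by (intro power_mono) (auto simp: dist_norm)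
  ultimately show ?thesis by (simp add: norm_divide power_divide)
qed

text \<open>
  If the conclusion fails, \<open>\<gamma>\<close> differs from every monomial occurring in a trigonometric polynomial
  \<open>|Q|\<^sup>2\<close> that peaks where all members of \<open>X\<close> are close to \<open>1\<close>, so that suitable averages nearly
  annihilate \<open>\<gamma> |Q|\<^sup>2\<close>.  But \<open>\<gamma>\<close> is close to \<open>1\<close> on the peak, and outside it \<open>|Q|\<^sup>2\<close>
  decays exponentially in the degree, whereas its average decays only polynomially.
\<close>

lemma (in group) circle_char_eq_monomial:
  assumes X: "finite X" "X \<subseteq> hom G circle_group" and \<gamma>: "\<gamma> \<in> hom G circle_group"
    and \<delta>: "\<delta> > 0"
    and near: "\<And>h. h \<in> carrier G \<Longrightarrow> (\<And>\<phi>. \<phi> \<in> X \<Longrightarrow> dist (\<phi> h) 1 < \<delta>) \<Longrightarrow> dist (\<gamma> h) 1 \<le> 1/4"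
  shows "\<exists>k l. \<forall>h\<in>carrier G. \<gamma> h = (\<Prod>\<phi>\<in>X. \<phi> h ^ k \<phi>) * cnj (\<Prod>\<phi>\<in>X. \<phi> h ^ l \<phi>)"
proof (rule ccontr)
  define mon where "mon k h = (\<Prod>\<phi>\<in>X. \<phi> h ^ k \<phi>)" for k :: "('a \<Rightarrow> complex) \<Rightarrow> nat" and h
  \<comment> \<open>Conjugates stand for negative exponents, so \<open>e k l\<close> is the monomial
    with integer exponents k - l.\<close>
  define e where "e k l = (\<lambda>h. mon k h * cnj (mon l h))" for k l
  assume "\<nexists>k l. \<forall>h\<in>carrier G. \<gamma> h = (\<Prod>\<phi>\<in>X. \<phi> h ^ k \<phi>) * cnj (\<Prod>\<phi>\<in>X. \<phi> h ^ l \<phi>)"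
  then have no: "\<exists>h\<in>carrier G. \<gamma> h \<noteq> mon k h * cnj (mon l h)" for k l
    unfolding mon_def by blast
  have mon_hom: "mon k \<in> hom G circle_group" for k
    unfolding mon_def[abs_def] using X by (intro circle_char_monomial)
  have e_hom: "e k l \<in> hom G circle_group" for k l
    unfolding e_def by (intro circle_char_times circle_char_cnj mon_hom)
  have \<gamma>e_hom: "(\<lambda>h. \<gamma> h * e k l h) \<in> hom G circle_group" for k l
    by (intro circle_char_times \<gamma> e_hom)
  have mon_cnj: "mon k h * cnj (mon k h) = 1" if "h \<in> carrier G" for k h
    using circle_char_norm[OF mon_hom that, of k] by (simp add: complex_norm_square[symmetric])
  \<comment> \<open>If this product were trivial, \<gamma> would be the conjugate of
    \<open>e k l\<close>, which is the excluded form with k and l interchanged.\<close>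
  have \<gamma>e_nontriv: "\<exists>h\<in>carrier G. \<gamma> h * e k l h \<noteq> 1" for k l
  proof -
    obtain h where h: "h \<in> carrier G" "\<gamma> h \<noteq> mon l h * cnj (mon k h)" using no by blast
    have "\<gamma> h * e k l h \<noteq> 1"
    proof
      assume *: "\<gamma> h * e k l h = 1"
      have "\<gamma> h = \<gamma> h * (mon k h * cnj (mon k h)) * (mon l h * cnj (mon l h))"
        using h(1) by (simp add: mon_cnj)
      also have "\<dots> = (\<gamma> h * e k l h) * (mon l h * cnj (mon k h))"
        by (simp add: e_def)
      finally show False using h(2) * by simp
    qed
    with h(1) show ?thesis by blast
  qed
  \<comment> \<open>Capping at 1 keeps \<open>r\<close> positive. By
    \<open>norm_mean_circle_le\<close>, \<open>r\<close> bounds the squared factor of a character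
    whose value is at distance at least d from 1.\<close>
  define d where "d = min \<delta> 1"
  define r where "r = 1 - d\<^sup>2 / 4"
  have d: "0 < d" "d \<le> 1" "d \<le> \<delta>" using \<delta> by (auto simp: d_def)
  have "d\<^sup>2 \<le> 1" using d by (simp add: power_le_one)
  then have r: "0 < r" "r < 1" using d by (auto simp: r_def)
  define n where "n = card X"
  \<comment> \<open>Here (M + 1)^n is the number N of monomials; the mean of |Q|^2 will be at least
    about 1/N, while |Q|^2 is at most r^M off the peak.\<close>
  have "(\<lambda>M. (real M + 1) ^ n * r ^ M) \<longlonglongrightarrow> 0"
    using r by real_asymp
  then have "\<forall>\<^sub>F M in sequentially. (real M + 1) ^ n * r ^ M < 1/8"
    by (rule order_tendstoD) simp
  then obtain M where M: "(real M + 1) ^ n * r ^ M < 1/8"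
    by (auto dest: eventually_happens)
  define N where "N = (real M + 1) ^ n"
  have N: "N > 0" by (simp add: N_def)
  define I where "I = (X \<rightarrow>\<^sub>E {..M})"
  have finI: "finite I" using X(1) by (auto simp: I_def intro: finite_PiE)
  have cardI: "real (card I) = N"
    using X(1) by (simp add: I_def card_PiE N_def n_def add.commute)
  define c where "c k = (\<Prod>\<phi>\<in>X. real (M choose k \<phi>) / 2 ^ M)" for k :: "('a \<Rightarrow> complex) \<Rightarrow> nat"
  have c_nonneg: "c k \<ge> 0" for k by (simp add: c_def prod_nonneg)
  define Q where "Q h = (\<Prod>\<phi>\<in>X. ((1 + \<phi> h) / 2) ^ M)" for h
  have Q: "Q h = (\<Sum>k\<in>I. of_real (c k) * mon k h)" for h
    unfolding Q_def I_def c_def mon_def using X(1) by (rule binomial_mean_expansion)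
  have "of_real (\<Sum>k\<in>I. c k) = (1::complex)"
    using binomial_mean_expansion[OF X(1), of "\<lambda>_. 1" M] by (simp add: I_def c_def)
  then have sum_c: "(\<Sum>k\<in>I. c k) = 1" by (metis of_real_eq_1_iff)
  \<comment> \<open>Chosen for the final count: after multiplication by N the lower bound is (1 -
    1/8) * 3/4 - 2 * N * r^M, which exceeds 21/32 - 1/4 = 13/32, against an upper bound of
    1/8.\<close>
  define \<epsilon> where "\<epsilon> = 1 / (8 * N)"
  have \<epsilon>: "\<epsilon> > 0" using N by (simp add: \<epsilon>_def)
  \<comment> \<open>Only nontrivial characters can be averaged away. An \<open>e k l\<close> may be
    trivial even for different k and l; it then has average 1, which only helps the lower bound for
    the mean of |Q|^2.\<close>
  define \<Psi> where "\<Psi> = {\<psi> \<in> (\<lambda>(k, l). e k l) ` (I \<times> I) \<union> (\<lambda>(k, l) h. \<gamma> h * e k l h) ` (I \<times> I).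
     \<exists>h\<in>carrier G. \<psi> h \<noteq> 1}"
  have "finite \<Psi>" using finI by (simp add: \<Psi>_def)
  moreover have "\<Psi> \<subseteq> hom G circle_group"
    unfolding \<Psi>_def using e_hom \<gamma>e_hom by auto
  moreover have "\<exists>h\<in>carrier G. \<psi> h \<noteq> 1" if "\<psi> \<in> \<Psi>" for \<psi>
    using that unfolding \<Psi>_def by blast
  ultimately obtain hs where hs: "hs \<noteq> []" "set hs \<subseteq> carrier G"
    and small: "\<And>\<psi>. \<psi> \<in> \<Psi> \<Longrightarrow> cmod (list_avg hs \<psi>) \<le> \<epsilon>"
    using exists_small_avg[OF _ _ _ \<epsilon>] by metis
  have A_\<gamma>e: "cmod (list_avg hs (\<lambda>h. \<gamma> h * e k l h)) \<le> \<epsilon>" if "k \<in> I" "l \<in> I" for k l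
  proof -
    have "(\<lambda>h. \<gamma> h * e k l h) \<in> (\<lambda>(k, l) h. \<gamma> h * e k l h) ` (I \<times> I)"
      using that by (intro image_eqI[of _ _ "(k, l)"]) simp_all
    then show ?thesis
      using \<gamma>e_nontriv[of k l] unfolding \<Psi>_def by (intro small[unfolded \<Psi>_def]) blast
  qed
  have A_e: "Re (list_avg hs (e k l)) \<ge> (if k = l then 1 else 0) - \<epsilon>" if kl: "k \<in> I" "l \<in> I" for k l
  proof (cases "\<exists>h\<in>carrier G. e k l h \<noteq> 1")
    case True
    moreover have "e k l \<in> (\<lambda>(k, l). e k l) ` (I \<times> I)"
      using kl by (intro image_eqI[of _ _ "(k, l)"]) simp_all
    ultimately have "cmod (list_avg hs (e k l)) \<le> \<epsilon>"
      by (intro small[unfolded \<Psi>_def]) blast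
    moreover have "k \<noteq> l" using True mon_cnj by (auto simp: e_def)
    ultimately show ?thesis
      using abs_Re_le_cmod[of "list_avg hs (e k l)"] by simp
  next
    case False
    then have "list_avg hs (e k l) = 1"
      using hs by (intro list_avg_const) auto
    then show ?thesis using \<epsilon> by simp
  qed
  define P where "P h = complex_of_real ((cmod (Q h))\<^sup>2)" for h
  have P: "P h = (\<Sum>i\<in>I\<times>I. of_real (c (fst i) * c (snd i)) * e (fst i) (snd i) h)" for h
  proof -
    have "P h = Q h * cnj (Q h)" by (simp only: P_def complex_norm_square)
    also have "\<dots> = (\<Sum>k\<in>I. \<Sum>l\<in>I. of_real (c k * c l) * e k l h)"
      unfolding Q e_def by (simp add: sum_product algebra_simps)
    finally show ?thesis by (simp add: sum.cartesian_product case_prod_beta)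
  qed
  have sum_cc: "(\<Sum>i\<in>I\<times>I. c (fst i) * c (snd i)) = 1"
    using sum_c by (simp add: sum_product[symmetric] sum.cartesian_product')
  have AP: "Re (list_avg hs P) \<ge> 1 / N - \<epsilon>"
  proof -
    \<comment> \<open>Cauchy-Schwarz: N coefficients with sum 1 have squares summing to at least
      1/N, and these squares are the weights of the diagonal terms \<open>e k k\<close>, which equal
      1 on the group.\<close>
    have "1 = (\<Sum>k\<in>I. c k)\<^sup>2" by (simp add: sum_c)
    also have "\<dots> \<le> (\<Sum>k\<in>I. (c k)\<^sup>2) * N"
      using sum_squared_le_sum_of_squares[of c I] cardI by simp
    finally have "1 / N \<le> (\<Sum>k\<in>I. (c k)\<^sup>2)" using N by (simp add: field_simps)
    moreover have "(\<Sum>k\<in>I. (c k)\<^sup>2) = (\<Sum>i\<in>I\<times>I. c (fst i) * c (snd i) * (if fst i = snd i then 1 else 0))"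
    proof -
      have "(\<Sum>l\<in>I. c k * c l * (if k = l then 1 else 0)) = (c k)\<^sup>2" if "k \<in> I" for k
        using that finI by (simp add: power2_eq_square if_distrib cong: if_cong)
      then show ?thesis by (simp add: sum.cartesian_product')
    qed
    moreover have "\<dots> - \<epsilon> = (\<Sum>i\<in>I\<times>I. c (fst i) * c (snd i) * ((if fst i = snd i then 1 else 0) - \<epsilon>))"
      by (simp only: right_diff_distrib sum_subtractf sum_distrib_right[symmetric] sum_cc mult_1)
    moreover have "\<dots> \<le> (\<Sum>i\<in>I\<times>I. c (fst i) * c (snd i) * Re (list_avg hs (e (fst i) (snd i))))"
      by (intro sum_mono mult_left_mono A_e mult_nonneg_nonneg c_nonneg) auto
    moreover have "\<dots> = Re (list_avg hs P)"
      unfolding P[abs_def] list_avg_sum_scaled by (simp del: of_real_mult)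
    ultimately show ?thesis by linarith
  qed
  have A\<gamma>P: "Re (list_avg hs (\<lambda>h. \<gamma> h * P h)) \<le> \<epsilon>"
  proof -
    have "(\<lambda>h. \<gamma> h * P h) = (\<lambda>h. \<Sum>i\<in>I\<times>I. of_real (c (fst i) * c (snd i)) * (\<gamma> h * e (fst i) (snd i) h))"
      unfolding P by (simp add: sum_distrib_left algebra_simps)
    then have "list_avg hs (\<lambda>h. \<gamma> h * P h) =
        (\<Sum>i\<in>I\<times>I. of_real (c (fst i) * c (snd i)) * list_avg hs (\<lambda>h. \<gamma> h * e (fst i) (snd i) h))"
      by (simp only: list_avg_sum_scaled)
    also have "cmod \<dots> \<le> (\<Sum>i\<in>I\<times>I. c (fst i) * c (snd i) * \<epsilon>)"
      by (intro sum_norm_le)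
        (auto simp: norm_mult c_nonneg intro!: mult_left_mono A_\<gamma>e mult_nonneg_nonneg)
    also have "\<dots> = \<epsilon>" by (simp only: sum_distrib_right[symmetric] sum_cc mult_1)
    finally show ?thesis using complex_Re_le_cmod order_trans by blast
  qed
  \<comment> \<open>On the peak the real part of \<gamma> is at least 3/4. Off it the real part is
    at least -1 and |Q|^2 is at most r^M, so the error (1 + 3/4) |Q|^2 is absorbed by 2 r^M.\<close>
  have pointwise: "Re (P h) * (3/4) - 2 * r ^ M \<le> Re (\<gamma> h * P h)" if h: "h \<in> carrier G" for h
  proof (cases "\<forall>\<phi>\<in>X. dist (\<phi> h) 1 < \<delta>")
    case True
    then have "cmod (1 - \<gamma> h) \<le> 1/4" using near[OF h] by (simp add: dist_norm norm_minus_commute)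
    then have "3/4 \<le> Re (\<gamma> h)" using complex_Re_le_cmod[of "1 - \<gamma> h"] by simp
    then have "Re (P h) * (3/4) \<le> Re (P h) * Re (\<gamma> h)"
      by (intro mult_left_mono) (auto simp: P_def)
    moreover have "0 \<le> r ^ M" using r by simp
    moreover have "Re (\<gamma> h * P h) = Re (P h) * Re (\<gamma> h)" by (simp add: P_def)
    ultimately show ?thesis by linarith
  next
    case False
    then obtain \<phi> where \<phi>: "\<phi> \<in> X" "d \<le> dist (\<phi> h) 1" using d by force
    have le1: "cmod ((1 + \<psi> h) / 2) \<le> 1" if "\<psi> \<in> X" for \<psi>
      using norm_triangle_ineq[of 1 "\<psi> h"] circle_char_norm[of \<psi> G h] X(2) h that
      by (auto simp: norm_divide)
    have "(cmod (Q h))\<^sup>2 = (\<Prod>\<psi>\<in>X. (cmod ((1 + \<psi> h) / 2))\<^sup>2 ^ M)"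
      by (simp add: Q_def prod_norm[symmetric] norm_power prod_power_distrib power_mult[symmetric] mult.commute)
    also have "\<dots> = (cmod ((1 + \<phi> h) / 2))\<^sup>2 ^ M * (\<Prod>\<psi>\<in>X - {\<phi>}. (cmod ((1 + \<psi> h) / 2))\<^sup>2 ^ M)"
      using X(1) \<phi>(1) by (rule prod.remove)
    also have "\<dots> \<le> r ^ M * 1"
    proof (intro mult_mono power_mono prod_le_1 prod_nonneg)
      show "(cmod ((1 + \<phi> h) / 2))\<^sup>2 \<le> r"
        unfolding r_def using X(2) \<phi> h d by (intro norm_mean_circle_le) (auto simp: circle_char_norm)
    next
      fix \<psi> assume "\<psi> \<in> X - {\<phi>}"
      then show "0 \<le> (cmod ((1 + \<psi> h) / 2))\<^sup>2 ^ M \<and> (cmod ((1 + \<psi> h) / 2))\<^sup>2 ^ M \<le> 1"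
        using le1[of \<psi>] by (auto intro!: power_le_one)
    qed (use r in auto)
    finally have "(cmod (Q h))\<^sup>2 \<le> r ^ M" by simp
    moreover have "- (cmod (Q h))\<^sup>2 \<le> Re (\<gamma> h) * (cmod (Q h))\<^sup>2"
      using abs_Re_le_cmod[of "\<gamma> h"] circle_char_norm[OF \<gamma> h]
        mult_right_mono[of "-1" "Re (\<gamma> h)" "(cmod (Q h))\<^sup>2"] by auto
    moreover have "0 \<le> (cmod (Q h))\<^sup>2" by simp
    moreover have "Re (P h) = (cmod (Q h))\<^sup>2" "Re (\<gamma> h * P h) = Re (\<gamma> h) * (cmod (Q h))\<^sup>2"
      by (simp_all add: P_def)
    ultimately show ?thesis by linarith
  qed
  have "Re (list_avg hs (\<lambda>h. P h * (3/4) - of_real (2 * r ^ M))) \<le> Re (list_avg hs (\<lambda>h. \<gamma> h * P h))"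
    using pointwise hs(2) by (intro Re_list_avg_mono) (auto simp: subset_iff)
  moreover have "list_avg hs (\<lambda>h. P h * (3/4) - of_real (2 * r ^ M)) =
      list_avg hs P * (3/4) - of_real (2 * r ^ M)"
  proof -
    have "(\<Sum>h\<leftarrow>hs. P h * (3/4) - of_real (2 * r ^ M)) =
        (\<Sum>h\<leftarrow>hs. P h) * (3/4) - of_nat (length hs) * of_real (2 * r ^ M)"
      by (induction hs) (simp_all add: algebra_simps)
    then show ?thesis using hs(1) by (simp add: list_avg_def field_simps)
  qed
  ultimately have "Re (list_avg hs P) * (3/4) - 2 * r ^ M \<le> \<epsilon>"
    using A\<gamma>P by simp
  with AP have "(1 / N - \<epsilon>) * (3/4) - 2 * r ^ M \<le> \<epsilon>" by argo
  then have "((1 / N - \<epsilon>) * (3/4) - 2 * r ^ M) * N \<le> \<epsilon> * N"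
    using N by (intro mult_right_mono) auto
  moreover have "\<epsilon> * N = 1/8" "((1 / N - \<epsilon>) * (3/4) - 2 * r ^ M) * N = 21/32 - 2 * (N * r ^ M)"
    using N by (simp_all add: \<epsilon>_def field_simps)
  moreover have "N * r ^ M < 1/8" using M by (simp add: N_def)
  ultimately show False by linarith
qed


section \<open>The dual group and its continuous characters\<close>

lemma topspace_circle_topology [simp]: "topspace circle_topology = sphere 0 1"
  by (simp add: circle_topology_def)

lemma openin_circle_topology:
  "openin circle_topology W \<longleftrightarrow>
    W \<subseteq> sphere 0 1 \<and> (\<forall>z\<in>W. \<exists>e>0. ball z e \<inter> sphere 0 1 \<subseteq> W)"
  unfolding circle_topology_def by (rule openin_contains_ball)

lemma openin_circle_ball: "openin circle_topology (ball z e \<inter> sphere 0 1)"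
  unfolding circle_topology_def openin_subtopology by auto

lemma continuous_map_circle_iff:
  "continuous_map X circle_topology \<phi> \<longleftrightarrow>
    (\<forall>x\<in>topspace X. \<phi> x \<in> sphere 0 1) \<and>
    (\<forall>x\<in>topspace X. \<forall>\<epsilon>>0. \<exists>V. openin X V \<and> x \<in> V \<and> (\<forall>y\<in>V. dist (\<phi> y) (\<phi> x) < \<epsilon>))"
  (is "?L \<longleftrightarrow> ?R1 \<and> ?R2")
proof (intro iffI conjI)
  assume L: ?L
  then show R1: ?R1 using continuous_map_image_subset_topspace by fastforce
  show ?R2
  proof (intro ballI allI impI)
    fix x and \<epsilon> :: real assume x: "x \<in> topspace X" and "\<epsilon> > 0"
    let ?V = "{y \<in> topspace X. \<phi> y \<in> ball (\<phi> x) \<epsilon> \<inter> sphere 0 1}"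
    have "openin X ?V" by (rule openin_continuous_map_preimage[OF L openin_circle_ball])
    moreover have "x \<in> ?V" using R1 x \<open>\<epsilon> > 0\<close> by auto
    ultimately show "\<exists>V. openin X V \<and> x \<in> V \<and> (\<forall>y\<in>V. dist (\<phi> y) (\<phi> x) < \<epsilon>)"
      by (intro exI[of _ ?V]) (auto simp: dist_commute)
  qed
next
  assume R: "?R1 \<and> ?R2"
  have "openin X {x \<in> topspace X. \<phi> x \<in> W}" if W: "openin circle_topology W" for W
  proof (subst openin_subopen, intro ballI)
    fix x assume x: "x \<in> {x \<in> topspace X. \<phi> x \<in> W}"
    then obtain e where e: "e > 0" "ball (\<phi> x) e \<inter> sphere 0 1 \<subseteq> W"
      using W unfolding openin_circle_topology by blast
    obtain V where V: "openin X V" "x \<in> V" "\<forall>y\<in>V. dist (\<phi> y) (\<phi> x) < e"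
      using R x e(1) by blast
    have "V \<subseteq> {x \<in> topspace X. \<phi> x \<in> W}"
    proof
      fix y assume y: "y \<in> V"
      then have "y \<in> topspace X" using openin_subset[OF V(1)] by blast
      then have "\<phi> y \<in> ball (\<phi> x) e \<inter> sphere 0 1" using R V(3) y by (auto simp: dist_commute)
      with e(2) \<open>y \<in> topspace X\<close> show "y \<in> {x \<in> topspace X. \<phi> x \<in> W}" by blast
    qed
    with V show "\<exists>V. openin X V \<and> x \<in> V \<and> V \<subseteq> {x \<in> topspace X. \<phi> x \<in> W}" by blast
  qed
  with R show ?L by (auto simp: continuous_map_def)
qed

lemma dist_circle_mult_le:
  fixes a b c d :: complex
  assumes "cmod b = 1" "cmod c = 1"
  shows "dist (a * b) (c * d) \<le> dist a c + dist b d"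
proof -
  have "a * b - c * d = (a - c) * b + c * (b - d)" by (simp add: algebra_simps)
  then show ?thesis
    using norm_triangle_ineq[of "(a - c) * b" "c * (b - d)"] assms by (simp add: dist_norm norm_mult)
qed

lemma continuous_chars_hom: "\<phi> \<in> continuous_chars G T \<Longrightarrow> \<phi> \<in> hom G circle_group"
  by (simp add: continuous_chars_def)

lemma continuous_chars_extensional: "\<phi> \<in> continuous_chars G T \<Longrightarrow> \<phi> \<in> extensional (carrier G)"
  by (simp add: continuous_chars_def)

lemma continuous_chars_continuous: "\<phi> \<in> continuous_chars G T \<Longrightarrow> continuous_map T circle_topology \<phi>"
  by (simp add: continuous_chars_def)

lemma eval_char_apply: "\<phi> \<in> continuous_chars G T \<Longrightarrow> eval_char G T x \<phi> = \<phi> x"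
  by (simp add: eval_char_def)

lemma dual_group_simps [simp]:
  "carrier (dual_group G T) = continuous_chars G T"
  "\<phi> \<otimes>\<^bsub>dual_group G T\<^esub> \<psi> = (\<lambda>x\<in>carrier G. \<phi> x * \<psi> x)"
  "\<one>\<^bsub>dual_group G T\<^esub> = (\<lambda>x\<in>carrier G. 1)"
  by (simp_all add: dual_group_def)

context abelian_topological_group
begin

lemma continuous_charsI:
  assumes "\<phi> \<in> hom G circle_group" "\<phi> \<in> extensional (carrier G)"
    and "\<And>x \<epsilon>. x \<in> carrier G \<Longrightarrow> \<epsilon> > 0 \<Longrightarrow>
      \<exists>V. openin T V \<and> x \<in> V \<and> (\<forall>y\<in>V. dist (\<phi> y) (\<phi> x) < \<epsilon>)"
  shows "\<phi> \<in> continuous_chars G T"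
  using assms circle_char_closed[OF assms(1)]
  by (auto simp: continuous_chars_def continuous_map_circle_iff topspace_eq)

lemma continuous_chars_nbhd:
  assumes "\<phi> \<in> continuous_chars G T" "x \<in> carrier G" "\<epsilon> > 0"
  obtains V where "openin T V" "x \<in> V" "\<And>y. y \<in> V \<Longrightarrow> dist (\<phi> y) (\<phi> x) < \<epsilon>"
  using continuous_chars_continuous[OF assms(1)] assms(2,3)
  unfolding continuous_map_circle_iff topspace_eq by blast

lemma openin_subset_carrier: "openin T V \<Longrightarrow> V \<subseteq> carrier G"
  using openin_subset topspace_eq by blast

lemma continuous_chars_mult:
  assumes \<phi>: "\<phi> \<in> continuous_chars G T" and \<psi>: "\<psi> \<in> continuous_chars G T"
  shows "(\<lambda>x\<in>carrier G. \<phi> x * \<psi> x) \<in> continuous_chars G T"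
proof (rule continuous_charsI)
  show "(\<lambda>x\<in>carrier G. \<phi> x * \<psi> x) \<in> hom G circle_group"
    using circle_char_times[OF \<phi>[THEN continuous_chars_hom] \<psi>[THEN continuous_chars_hom]]
    by (auto simp: hom_def)
  fix x and \<epsilon> :: real assume x: "x \<in> carrier G" and "\<epsilon> > 0"
  then have "\<epsilon> / 2 > 0" by simp
  obtain V where V: "openin T V" "x \<in> V" "\<And>y. y \<in> V \<Longrightarrow> dist (\<phi> y) (\<phi> x) < \<epsilon> / 2"
    using continuous_chars_nbhd[OF \<phi> x \<open>\<epsilon> / 2 > 0\<close>] by blast
  obtain W where W: "openin T W" "x \<in> W" "\<And>y. y \<in> W \<Longrightarrow> dist (\<psi> y) (\<psi> x) < \<epsilon> / 2"
    using continuous_chars_nbhd[OF \<psi> x \<open>\<epsilon> / 2 > 0\<close>] by blast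
  have "dist (\<phi> y * \<psi> y) (\<phi> x * \<psi> x) < \<epsilon>" "y \<in> carrier G" if "y \<in> V \<inter> W" for y
  proof -
    show y: "y \<in> carrier G" using that openin_subset_carrier[OF V(1)] by blast
    have "dist (\<phi> y * \<psi> y) (\<phi> x * \<psi> x) \<le> dist (\<phi> y) (\<phi> x) + dist (\<psi> y) (\<psi> x)"
      using x y \<phi> \<psi> by (intro dist_circle_mult_le circle_char_norm[OF continuous_chars_hom])
    with V(3)[of y] W(3)[of y] that show "dist (\<phi> y * \<psi> y) (\<phi> x * \<psi> x) < \<epsilon>" by simp
  qed
  then show "\<exists>V. openin T V \<and> x \<in> V \<and>
      (\<forall>y\<in>V. dist ((\<lambda>x\<in>carrier G. \<phi> x * \<psi> x) y) ((\<lambda>x\<in>carrier G. \<phi> x * \<psi> x) x) < \<epsilon>)"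
    using V W x by (intro exI[of _ "V \<inter> W"]) auto
qed auto

lemma continuous_chars_cnj:
  assumes \<phi>: "\<phi> \<in> continuous_chars G T"
  shows "(\<lambda>x\<in>carrier G. cnj (\<phi> x)) \<in> continuous_chars G T"
proof (rule continuous_charsI)
  show "(\<lambda>x\<in>carrier G. cnj (\<phi> x)) \<in> hom G circle_group"
    using circle_char_cnj[OF \<phi>[THEN continuous_chars_hom]] by (auto simp: hom_def)
  fix x and \<epsilon> :: real assume x: "x \<in> carrier G" and "\<epsilon> > 0"
  obtain V where V: "openin T V" "x \<in> V" "\<And>y. y \<in> V \<Longrightarrow> dist (\<phi> y) (\<phi> x) < \<epsilon>"
    using continuous_chars_nbhd[OF \<phi> x \<open>\<epsilon> > 0\<close>] by blast
  have "dist (cnj (\<phi> y)) (cnj (\<phi> x)) < \<epsilon>" "y \<in> carrier G" if "y \<in> V" for y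
    using V(3)[OF that] openin_subset_carrier[OF V(1)] that
    by (auto simp: dist_norm complex_cnj_diff[symmetric] simp del: complex_cnj_diff)
  then show "\<exists>V. openin T V \<and> x \<in> V \<and>
      (\<forall>y\<in>V. dist ((\<lambda>x\<in>carrier G. cnj (\<phi> x)) y) ((\<lambda>x\<in>carrier G. cnj (\<phi> x)) x) < \<epsilon>)"
    using V x by (intro exI[of _ V]) auto
qed auto

lemma comm_group_dual_group: "comm_group (dual_group G T)"
proof (rule comm_groupI)
  show "\<one>\<^bsub>dual_group G T\<^esub> \<in> carrier (dual_group G T)"
    unfolding dual_group_simps
  proof (rule continuous_charsI)
    show "(\<lambda>x\<in>carrier G. 1) \<in> hom G circle_group"
      by (auto simp: hom_def circle_group_def)
    show "\<exists>V. openin T V \<and> x \<in> V \<and>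
        (\<forall>y\<in>V. dist ((\<lambda>x\<in>carrier G. 1 :: complex) y) ((\<lambda>x\<in>carrier G. 1) x) < \<epsilon>)"
      if "x \<in> carrier G" "\<epsilon> > 0" for x and \<epsilon> :: real
      using that openin_topspace[of T] by (intro exI[of _ "carrier G"]) (auto simp: topspace_eq)
  qed auto
next
  fix \<phi> assume \<phi>: "\<phi> \<in> carrier (dual_group G T)"
  then show "\<one>\<^bsub>dual_group G T\<^esub> \<otimes>\<^bsub>dual_group G T\<^esub> \<phi> = \<phi>"
    using continuous_chars_extensional by (fastforce simp: extensional_def)
  have "cnj (\<phi> x) * \<phi> x = 1" if "x \<in> carrier G" for x
    using circle_char_norm[OF continuous_chars_hom that, of \<phi> T] \<phi>
    by (simp add: mult.commute[of "cnj _"] complex_norm_square[symmetric])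
  then show "\<exists>\<psi>\<in>carrier (dual_group G T). \<psi> \<otimes>\<^bsub>dual_group G T\<^esub> \<phi> = \<one>\<^bsub>dual_group G T\<^esub>"
    using continuous_chars_cnj[of \<phi>] \<phi> by (intro bexI[of _ "\<lambda>x\<in>carrier G. cnj (\<phi> x)"]) auto
qed (auto simp: continuous_chars_mult mult_ac)

lemma eval_char_continuous_char:
  assumes x: "x \<in> carrier G"
  shows "eval_char G T x \<in> continuous_chars (dual_group G T) (pointwise_topology G T)"
proof -
  have "eval_char G T x \<in> hom (dual_group G T) circle_group"
    using x circle_char_norm[OF continuous_chars_hom x]
    by (auto simp: hom_def eval_char_def circle_group_def continuous_chars_mult)
  moreover have "continuous_map (pointwise_topology G T) circle_topology (eval_char G T x)"
  proof (rule continuous_map_eq)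
    show "continuous_map (pointwise_topology G T) circle_topology (\<lambda>\<phi>. \<phi> x)"
      unfolding pointwise_topology_def
      using x by (intro continuous_map_from_subtopology continuous_map_product_coordinates)
  qed (simp add: eval_char_apply)
  ultimately show ?thesis by (simp add: continuous_chars_def eval_char_def)
qed

text \<open>
  The dual of \<open>(G\<^sup>\<and>, \<sigma>(G\<^sup>\<and>, G))\<close> is \<open>G\<close> (Comfort and Ross): a neighbourhood of the trivial
  character on which \<open>\<gamma>\<close> is close to \<open>1\<close> is determined by finitely many evaluations, and \<open>\<gamma>\<close>
  is a monomial in these.
\<close>

lemma continuous_chars_pointwise_dual:
  "continuous_chars (dual_group G T) (pointwise_topology G T) = eval_char G T ` carrier G"
proof
  show "eval_char G T ` carrier G \<subseteq> continuous_chars (dual_group G T) (pointwise_topology G T)"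
    using eval_char_continuous_char by blast
next
  interpret D: comm_group "dual_group G T" by (rule comm_group_dual_group)
  show "continuous_chars (dual_group G T) (pointwise_topology G T) \<subseteq> eval_char G T ` carrier G"
  proof
    fix \<gamma> assume \<gamma>: "\<gamma> \<in> continuous_chars (dual_group G T) (pointwise_topology G T)"
    \<comment> \<open>The radius 1/4 is the closeness that \<open>circle_char_eq_monomial\<close>
      requires of \<gamma>.\<close>
    let ?V = "{\<phi> \<in> continuous_chars G T. \<gamma> \<phi> \<in> ball 1 (1/4) \<inter> sphere 0 1}"
    have "openin (pointwise_topology G T) ?V"
      using openin_continuous_map_preimage[OF continuous_chars_continuous[OF \<gamma>] openin_circle_ball[of 1 "1/4"]]
      by simp
    then obtain S where S: "openin (product_topology (\<lambda>_. circle_topology) (carrier G)) S"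
      "?V = S \<inter> continuous_chars G T"
      unfolding pointwise_topology_def openin_subtopology by blast
    have "\<one>\<^bsub>dual_group G T\<^esub> \<in> ?V"
      using D.circle_char_one[OF continuous_chars_hom[OF \<gamma>]] D.one_closed by simp
    then have "\<one>\<^bsub>dual_group G T\<^esub> \<in> S" using S(2) by blast
    then obtain U where U: "finite {x \<in> carrier G. U x \<noteq> topspace circle_topology}"
      "\<forall>x\<in>carrier G. openin circle_topology (U x)" "\<one>\<^bsub>dual_group G T\<^esub> \<in> Pi\<^sub>E (carrier G) U"
      "Pi\<^sub>E (carrier G) U \<subseteq> S"
      using S(1) unfolding openin_product_topology_alt by meson
    define F where "F = {x \<in> carrier G. U x \<noteq> topspace circle_topology}"
    have F: "finite F" "F \<subseteq> carrier G" using U(1) by (auto simp: F_def)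
    have "\<exists>e>0. ball 1 e \<inter> sphere 0 1 \<subseteq> U x" if "x \<in> F" for x
    proof -
      have "x \<in> carrier G" using F(2) that by blast
      then have "1 \<in> U x" "openin circle_topology (U x)" using U(2,3) by (auto simp: PiE_iff)
      then show ?thesis unfolding openin_circle_topology by blast
    qed
    then obtain e where e: "\<And>x. x \<in> F \<Longrightarrow> e x > 0" "\<And>x. x \<in> F \<Longrightarrow> ball 1 (e x) \<inter> sphere 0 1 \<subseteq> U x"
      by metis
    \<comment> \<open>The inserted 1 keeps the set nonempty when no coordinate is
      restricted.\<close>
    define \<delta> where "\<delta> = Min (insert 1 (e ` F))"
    have \<delta>: "\<delta> > 0" "\<And>x. x \<in> F \<Longrightarrow> \<delta> \<le> e x"
      using F(1) e(1) by (auto simp: \<delta>_def)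
    define X where "X = eval_char G T ` F"
    have X: "finite X" "X \<subseteq> eval_char G T ` carrier G" using F by (auto simp: X_def)
    have X_hom: "X \<subseteq> hom (dual_group G T) circle_group"
      using X(2) eval_char_continuous_char continuous_chars_hom by blast
    have near: "dist (\<gamma> \<phi>) 1 \<le> 1/4"
      if \<phi>: "\<phi> \<in> carrier (dual_group G T)" and close: "\<And>\<psi>. \<psi> \<in> X \<Longrightarrow> dist (\<psi> \<phi>) 1 < \<delta>" for \<phi>
    proof -
      have \<phi>': "\<phi> \<in> continuous_chars G T" using \<phi> by simp
      have "\<phi> x \<in> U x" if x: "x \<in> carrier G" for x
      proof (cases "x \<in> F")
        case True
        then have "dist (\<phi> x) 1 < e x"
          using close[of "eval_char G T x"] \<delta>(2)[of x] \<phi>' by (simp add: X_def eval_char_apply)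
        then show ?thesis
          using e(2)[OF True] circle_char_closed[OF continuous_chars_hom[OF \<phi>'] x]
          by (auto simp: dist_commute)
      next
        case False
        then have "U x = sphere 0 1" using x by (simp add: F_def)
        then show ?thesis using circle_char_closed[OF continuous_chars_hom[OF \<phi>'] x] by simp
      qed
      then have "\<phi> \<in> Pi\<^sub>E (carrier G) U"
        using continuous_chars_extensional[OF \<phi>'] by (simp add: PiE_iff)
      then have "\<phi> \<in> ?V" using U(4) S(2) \<phi>' by blast
      then show ?thesis by (simp add: dist_commute)
    qed
    have "\<exists>k l. \<forall>\<phi>\<in>carrier (dual_group G T).
        \<gamma> \<phi> = (\<Prod>\<psi>\<in>X. \<psi> \<phi> ^ k \<psi>) * cnj (\<Prod>\<psi>\<in>X. \<psi> \<phi> ^ l \<psi>)"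
      using near by (rule D.circle_char_eq_monomial[OF X(1) X_hom continuous_chars_hom[OF \<gamma>] \<delta>(1)])
    then obtain k l where kl: "\<And>\<phi>. \<phi> \<in> continuous_chars G T \<Longrightarrow>
        \<gamma> \<phi> = (\<Prod>\<psi>\<in>X. \<psi> \<phi> ^ k \<psi>) * cnj (\<Prod>\<psi>\<in>X. \<psi> \<phi> ^ l \<psi>)"
      unfolding dual_group_simps(1) by blast
    \<comment> \<open>Members of \<open>X\<close> are evaluations, so a product of their powers is
      evaluation at the corresponding product of powers of points of G.\<close>
    have monomial: "\<exists>x\<in>carrier G. \<forall>\<phi>\<in>continuous_chars G T. \<phi> x = (\<Prod>\<psi>\<in>X. \<psi> \<phi> ^ k \<psi>)"
      for k :: "(('a \<Rightarrow> complex) \<Rightarrow> complex) \<Rightarrow> nat"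
      using X
    proof (induction X)
      case empty
      then show ?case
        using circle_char_one[OF continuous_chars_hom] by (intro bexI[of _ \<one>]) auto
    next
      case (insert \<psi> X)
      then obtain x where x: "x \<in> carrier G"
        "\<And>\<phi>. \<phi> \<in> continuous_chars G T \<Longrightarrow> \<phi> x = (\<Prod>\<psi>\<in>X. \<psi> \<phi> ^ k \<psi>)"
        by auto
      obtain y where y: "y \<in> carrier G" "\<psi> = eval_char G T y" using insert.prems by blast
      have "\<phi> (y [^] k \<psi> \<otimes> x) = (\<Prod>\<psi>\<in>insert \<psi> X. \<psi> \<phi> ^ k \<psi>)" if "\<phi> \<in> continuous_chars G T" for \<phi>
      proof -
        have "\<phi> (y [^] k \<psi> \<otimes> x) = \<phi> y ^ k \<psi> * \<phi> x"
          using x(1) y(1) continuous_chars_hom[OF that]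
          by (simp add: circle_char_mult circle_char_pow)
        moreover have "\<phi> y = \<psi> \<phi>" using that by (simp add: y(2) eval_char_apply)
        ultimately show ?thesis using insert.hyps x(2)[OF that] by simp
      qed
      then show ?case using x(1) y(1) by (intro bexI[of _ "y [^] k \<psi> \<otimes> x"]) auto
    qed
    obtain x where x: "x \<in> carrier G"
      "\<And>\<phi>. \<phi> \<in> continuous_chars G T \<Longrightarrow> \<phi> x = (\<Prod>\<psi>\<in>X. \<psi> \<phi> ^ k \<psi>)"
      using monomial[of k] by blast
    obtain y where y: "y \<in> carrier G"
      "\<And>\<phi>. \<phi> \<in> continuous_chars G T \<Longrightarrow> \<phi> y = (\<Prod>\<psi>\<in>X. \<psi> \<phi> ^ l \<psi>)"
      using monomial[of l] by blast
    \<comment> \<open>Conjugation inverts a circle value, so the conjugated monomial, evaluation at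
      y, becomes evaluation at \<open>inv y\<close>.\<close>
    have "\<gamma> = eval_char G T (x \<otimes> inv y)"
    proof (rule extensionalityI)
      show "\<gamma> \<in> extensional (continuous_chars G T)"
        using continuous_chars_extensional[OF \<gamma>] by simp
      show "eval_char G T (x \<otimes> inv y) \<in> extensional (continuous_chars G T)"
        by (simp add: eval_char_def)
      show "\<gamma> \<phi> = eval_char G T (x \<otimes> inv y) \<phi>" if "\<phi> \<in> continuous_chars G T" for \<phi>
        using kl[OF that] x(2)[OF that] y(2)[OF that] x(1) y(1) continuous_chars_hom[OF that]
        by (simp add: eval_char_apply[OF that] circle_char_mult circle_char_inv)
    qed
    then show "\<gamma> \<in> eval_char G T ` carrier G" using x(1) y(1) by auto
  qed
qed

end


section \<open>Topologies of uniform convergence\<close>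

text \<open>\<open>uniform_nbhd\<close> itself need not be open: over infinitely many characters the
  strict inequalities may leave no common margin. The set \<open>?V\<close> demands a common bound d
  < \<epsilon>, and half of the margin \<epsilon> - d is then available around each of its
  points.\<close>

lemma uniform_nbhd_contains_open:
  assumes "finite \<F>" "\<F> \<subseteq> \<K>" "\<epsilon> > 0" "x \<in> carrier G"
  obtains V where "openin (uniform_convergence_topology G \<K>) V" "x \<in> V" "V \<subseteq> uniform_nbhd G \<F> \<epsilon> x"
proof -
  let ?V = "{y \<in> carrier G. \<exists>d<\<epsilon>. \<forall>K\<in>\<F>. \<forall>\<phi>\<in>K. dist (\<phi> y) (\<phi> x) \<le> d}"
  have "\<exists>\<F> \<epsilon>. finite \<F> \<and> \<F> \<subseteq> \<K> \<and> 0 < \<epsilon> \<and> uniform_nbhd G \<F> \<epsilon> y \<subseteq> ?V" if y: "y \<in> ?V" for y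
  proof -
    obtain d where d: "d < \<epsilon>" "\<And>K \<phi>. K \<in> \<F> \<Longrightarrow> \<phi> \<in> K \<Longrightarrow> dist (\<phi> y) (\<phi> x) \<le> d"
      using y by blast
    have "uniform_nbhd G \<F> ((\<epsilon> - d) / 2) y \<subseteq> ?V"
    proof
      fix z assume z: "z \<in> uniform_nbhd G \<F> ((\<epsilon> - d) / 2) y"
      have "dist (\<phi> z) (\<phi> x) \<le> d + (\<epsilon> - d) / 2" if "K \<in> \<F>" "\<phi> \<in> K" for K \<phi>
      proof -
        have "dist (\<phi> z) (\<phi> y) < (\<epsilon> - d) / 2"
          using z that unfolding uniform_nbhd_def by blast
        then show ?thesis
          using d(2)[OF that] dist_triangle[of "\<phi> z" "\<phi> x" "\<phi> y"] by linarith
      qed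
      moreover have "d + (\<epsilon> - d) / 2 < \<epsilon>" using d(1) by (simp add: field_simps)
      moreover have "z \<in> carrier G" using z by (simp add: uniform_nbhd_def)
      ultimately show "z \<in> ?V" by blast
    qed
    then show ?thesis using assms(1,2) d(1) by (intro exI[of _ \<F>] exI[of _ "(\<epsilon> - d) / 2"]) auto
  qed
  then have "openin (uniform_convergence_topology G \<K>) ?V"
    unfolding openin_uniform_convergence_topology by blast
  moreover have "x \<in> ?V" using assms by auto
  moreover have "?V \<subseteq> uniform_nbhd G \<F> \<epsilon> x"
    by (force simp: uniform_nbhd_def)
  ultimately show thesis by (rule that)
qed

text \<open>The estimates for products and inverses of circle values involve no constant depending
  on the character, so they hold uniformly on every member of \<open>\<K>\<close>.\<close>

lemma (in comm_group) abelian_topological_group_uniform_convergence: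
  assumes "\<Union>\<K> \<subseteq> hom G circle_group"
  shows "abelian_topological_group G (uniform_convergence_topology G \<K>)"
proof
  let ?T = "uniform_convergence_topology G \<K>"
  show "topspace ?T = carrier G" by simp
  show "continuous_map (prod_topology ?T ?T) ?T (\<lambda>(x, y). x \<otimes> y)"
    unfolding continuous_map_def
  proof (intro conjI allI impI)
    fix U assume U: "openin ?T U"
    show "openin (prod_topology ?T ?T) {p \<in> topspace (prod_topology ?T ?T). (case p of (x, y) \<Rightarrow> x \<otimes> y) \<in> U}"
      unfolding openin_prod_topology_alt
    proof (intro allI impI)
      fix x y assume "(x, y) \<in> {p \<in> topspace (prod_topology ?T ?T). (case p of (x, y) \<Rightarrow> x \<otimes> y) \<in> U}"
      then have xy: "x \<in> carrier G" "y \<in> carrier G" "x \<otimes> y \<in> U" by auto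
      obtain \<F> \<epsilon> where \<F>: "finite \<F>" "\<F> \<subseteq> \<K>" "0 < \<epsilon>" "uniform_nbhd G \<F> \<epsilon> (x \<otimes> y) \<subseteq> U"
        using U xy(3) unfolding openin_uniform_convergence_topology by blast
      have \<epsilon>2: "\<epsilon> / 2 > 0" using \<F>(3) by simp
      obtain V where V: "openin ?T V" "x \<in> V" "V \<subseteq> uniform_nbhd G \<F> (\<epsilon> / 2) x"
        by (rule uniform_nbhd_contains_open[OF \<F>(1,2) \<epsilon>2 xy(1)])
      obtain W where W: "openin ?T W" "y \<in> W" "W \<subseteq> uniform_nbhd G \<F> (\<epsilon> / 2) y"
        by (rule uniform_nbhd_contains_open[OF \<F>(1,2) \<epsilon>2 xy(2)])
      have "v \<otimes> w \<in> U" "v \<in> carrier G" "w \<in> carrier G" if "v \<in> V" "w \<in> W" for v w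
      proof -
        have v: "v \<in> uniform_nbhd G \<F> (\<epsilon> / 2) x" and w: "w \<in> uniform_nbhd G \<F> (\<epsilon> / 2) y"
          using that V(3) W(3) by auto
        show vw: "v \<in> carrier G" "w \<in> carrier G"
          using v w by (auto simp: uniform_nbhd_def)
        have "dist (\<phi> (v \<otimes> w)) (\<phi> (x \<otimes> y)) < \<epsilon>" if "K \<in> \<F>" "\<phi> \<in> K" for K \<phi>
        proof -
          have \<phi>: "\<phi> \<in> hom G circle_group" using that \<F>(2) assms by blast
          have "dist (\<phi> v * \<phi> w) (\<phi> x * \<phi> y) \<le> dist (\<phi> v) (\<phi> x) + dist (\<phi> w) (\<phi> y)"
            using vw xy by (intro dist_circle_mult_le circle_char_norm[OF \<phi>])
          moreover have "dist (\<phi> v) (\<phi> x) < \<epsilon> / 2" "dist (\<phi> w) (\<phi> y) < \<epsilon> / 2"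
            using v w that unfolding uniform_nbhd_def by blast+
          ultimately show ?thesis using vw xy by (simp add: circle_char_mult[OF \<phi>])
        qed
        then have "v \<otimes> w \<in> uniform_nbhd G \<F> \<epsilon> (x \<otimes> y)"
          using vw by (auto simp: uniform_nbhd_def)
        then show "v \<otimes> w \<in> U" using \<F>(4) by blast
      qed
      then show "\<exists>V W. openin ?T V \<and> openin ?T W \<and> x \<in> V \<and> y \<in> W \<and>
          V \<times> W \<subseteq> {p \<in> topspace (prod_topology ?T ?T). (case p of (x, y) \<Rightarrow> x \<otimes> y) \<in> U}"
        using V W by (intro exI[of _ V] exI[of _ W]) auto
    qed
  qed auto
  show "continuous_map ?T ?T (\<lambda>x. inv x)"
    unfolding continuous_map_def
  proof (intro conjI allI impI)
    fix U assume U: "openin ?T U"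
    show "openin ?T {x \<in> topspace ?T. inv x \<in> U}"
    proof (subst openin_uniform_convergence_topology, intro conjI ballI)
      fix x assume "x \<in> {x \<in> topspace ?T. inv x \<in> U}"
      then have x: "x \<in> carrier G" "inv x \<in> U" by auto
      obtain \<F> \<epsilon> where \<F>: "finite \<F>" "\<F> \<subseteq> \<K>" "0 < \<epsilon>" "uniform_nbhd G \<F> \<epsilon> (inv x) \<subseteq> U"
        using U x(2) unfolding openin_uniform_convergence_topology by blast
      have "inv y \<in> U" if y: "y \<in> uniform_nbhd G \<F> \<epsilon> x" for y
      proof -
        have yc: "y \<in> carrier G" using y by (simp add: uniform_nbhd_def)
        have "dist (\<phi> (inv y)) (\<phi> (inv x)) < \<epsilon>" if "K \<in> \<F>" "\<phi> \<in> K" for K \<phi>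
        proof -
          have \<phi>: "\<phi> \<in> hom G circle_group" using that \<F>(2) assms by blast
          have "dist (\<phi> y) (\<phi> x) < \<epsilon>" using y that unfolding uniform_nbhd_def by blast
          then show ?thesis
            using yc x by (simp add: circle_char_inv[OF \<phi>] dist_norm complex_cnj_diff[symmetric]
                del: complex_cnj_diff)
        qed
        then have "inv y \<in> uniform_nbhd G \<F> \<epsilon> (inv x)" using yc by (auto simp: uniform_nbhd_def)
        then show ?thesis using \<F>(4) by blast
      qed
      then show "\<exists>\<F> \<epsilon>. finite \<F> \<and> \<F> \<subseteq> \<K> \<and> 0 < \<epsilon> \<and>
          uniform_nbhd G \<F> \<epsilon> x \<subseteq> {x \<in> topspace ?T. inv x \<in> U}"
        using \<F>(1-3) by (intro exI[of _ \<F>] exI[of _ \<epsilon>]) (auto simp: uniform_nbhd_def)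
    qed auto
  qed auto
qed

section \<open>The arc T_+ and repeated squaring\<close>

text \<open>The angle 2 \<pi> t ranges over the interval from -\<pi>/2 to \<pi>/2, where the cosine
  is nonnegative; conversely t is read off from the principal logarithm.\<close>

lemma circle_plus_iff: "z \<in> circle_plus \<longleftrightarrow> cmod z = 1 \<and> 0 \<le> Re z"
proof
  assume "z \<in> circle_plus"
  then obtain t :: real where t: "z = exp (2 * of_real pi * \<i> * of_real t)" "-1/4 \<le> t" "t \<le> 1/4"
    unfolding circle_plus_def by blast
  then have z: "z = cis (2 * pi * t)" by (simp add: cis_conv_exp mult_ac)
  have "- (pi / 2) \<le> 2 * pi * t" "2 * pi * t \<le> pi / 2"
    using t(2,3) mult_left_mono[of "-1/4" t "2 * pi"] mult_left_mono[of t "1/4" "2 * pi"] by auto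
  then have "0 \<le> cos (2 * pi * t)" by (intro cos_ge_zero) auto
  then show "cmod z = 1 \<and> 0 \<le> Re z" by (simp add: z)
next
  assume z: "cmod z = 1 \<and> 0 \<le> Re z"
  then have "z \<noteq> 0" by auto
  then have Im: "\<bar>Im (Ln z)\<bar> \<le> pi / 2" using Re_Ln_pos_le z by blast
  have "Re (Ln z) = 0" using z \<open>z \<noteq> 0\<close> by simp
  then have Ln: "Ln z = \<i> * of_real (Im (Ln z))" by (simp add: complex_eq_iff)
  define t where "t = Im (Ln z) / (2 * pi)"
  have "z = exp (2 * of_real pi * \<i> * of_real t)"
    using exp_Ln[OF \<open>z \<noteq> 0\<close>] Ln by (simp add: t_def)
  moreover have "-1/4 \<le> t" "t \<le> 1/4" using Im by (auto simp: t_def field_simps)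
  ultimately show "z \<in> circle_plus" unfolding circle_plus_def by blast
qed

text \<open>For z on the circle with nonnegative real part, |z + 1| is at least sqrt 2, and |z^2 -
  1| = |z - 1| |z + 1|. Every squaring therefore gains a factor sqrt 2, starting from the trivial
  bound 2.\<close>

lemma dist_one_le_of_powers_Re_nonneg:
  fixes z :: complex
  assumes "cmod z = 1" "\<And>j. j < m \<Longrightarrow> 0 \<le> Re (z ^ 2 ^ j)"
  shows "dist z 1 \<le> 2 / sqrt 2 ^ m"
  using assms
proof (induction m arbitrary: z)
  case 0
  then show ?case using norm_triangle_ineq4[of z 1] by (simp add: dist_norm)
next
  case (Suc m)
  have "0 \<le> Re ((z\<^sup>2) ^ 2 ^ j)" if "j < m" for j
    using Suc.prems(2)[of "Suc j"] that by (simp add: power_mult[symmetric])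
  then have IH: "dist (z\<^sup>2) 1 \<le> 2 / sqrt 2 ^ m"
    using Suc.prems(1) by (intro Suc.IH) (simp_all add: norm_power)
  have "0 \<le> Re z" using Suc.prems(2)[of 0] by simp
  have "(Re z)\<^sup>2 + (Im z)\<^sup>2 = 1" using Suc.prems(1) by (simp add: cmod_def)
  then have "(cmod (z + 1))\<^sup>2 = 2 + 2 * Re z"
    unfolding cmod_power2 by (simp add: power2_eq_square algebra_simps)
  then have "sqrt 2 \<le> cmod (z + 1)" using \<open>0 \<le> Re z\<close> by (intro real_le_lsqrt real_sqrt_le_iff'[THEN iffD2]) auto
  then have "dist z 1 * sqrt 2 \<le> dist z 1 * cmod (z + 1)" by (intro mult_left_mono) auto
  also have "\<dots> = dist (z\<^sup>2) 1"
    by (simp add: dist_norm norm_mult[symmetric] power2_eq_square algebra_simps)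
  finally have "dist z 1 * sqrt 2 \<le> 2 / sqrt 2 ^ m" using IH by simp
  then show ?case by (simp add: field_simps)
qed

section \<open>The topology \<open>tau_K\<close>, equicontinuity and g-barrelledness\<close>

context abelian_topological_group
begin

lemma pointwise_topology_eq_of_same_chars:
  "continuous_chars G T' = continuous_chars G T \<Longrightarrow> pointwise_topology G T' = pointwise_topology G T"
  by (simp add: pointwise_topology_def)

lemma compact_subset_chars:
  "compactin (pointwise_topology G T) K \<Longrightarrow> K \<subseteq> continuous_chars G T"
  using compactin_subset_topspace by fastforce

lemma abelian_topological_group_tau_K: "abelian_topological_group G (tau_K G T)"
  unfolding tau_K_def
  using compact_subset_chars continuous_chars_hom
  by (intro abelian_topological_group_uniform_convergence) blast

text \<open>Singletons are \<sigma>-compact, so \<open>tau_K\<close> makes every given character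
  continuous. Compatibility is thus only a question of the opposite inclusion.\<close>

lemma continuous_chars_subset_tau_K: "continuous_chars G T \<subseteq> continuous_chars G (tau_K G T)"
proof
  interpret K: abelian_topological_group G "tau_K G T" by (rule abelian_topological_group_tau_K)
  fix \<phi> assume \<phi>: "\<phi> \<in> continuous_chars G T"
  then have cpt: "compactin (pointwise_topology G T) {\<phi>}"
    by (intro finite_imp_compactin) auto
  show "\<phi> \<in> continuous_chars G (tau_K G T)"
  proof (rule K.continuous_charsI)
    fix x and \<epsilon> :: real assume x: "x \<in> carrier G" and "\<epsilon> > 0"
    obtain V where "openin (tau_K G T) V" "x \<in> V" "V \<subseteq> uniform_nbhd G {{\<phi>}} \<epsilon> x"
      unfolding tau_K_def
      by (rule uniform_nbhd_contains_open[of "{{\<phi>}}" "{K. compactin (pointwise_topology G T) K}" \<epsilon> x G])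
        (use cpt x \<open>\<epsilon> > 0\<close> in auto)
    then show "\<exists>V. openin (tau_K G T) V \<and> x \<in> V \<and> (\<forall>y\<in>V. dist (\<phi> y) (\<phi> x) < \<epsilon>)"
      by (intro exI[of _ V]) (auto simp: uniform_nbhd_def)
  qed (use \<phi> continuous_chars_hom continuous_chars_extensional in auto)
qed

lemma openin_translate:
  assumes V: "openin T V" and a: "a \<in> carrier G"
  shows "openin T {x \<in> carrier G. a \<otimes> x \<in> V}"
proof -
  have "continuous_map T T (\<lambda>x. a \<otimes> x)"
    using continuous_map_compose[OF _ continuous_mult, of T "\<lambda>x. (a, x)"] a topspace_eq
    by (simp add: comp_def continuous_map_pairwise)
  from openin_continuous_map_preimage[OF this V] show ?thesis
    by (simp add: topspace_eq)
qed

lemma openin_power_preimage: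
  assumes V: "openin T V"
  shows "openin T {x \<in> carrier G. x [^] (n::nat) \<in> V}"
proof -
  have "continuous_map T T (\<lambda>x. x [^] n)"
  proof (induction n)
    case 0
    then show ?case using topspace_eq by simp
  next
    case (Suc n)
    have "continuous_map T (prod_topology T T) (\<lambda>x. (x [^] n, x))"
      using Suc by (simp add: continuous_map_pairwise comp_def continuous_map_id[unfolded id_def])
    then show ?case
      using continuous_map_compose[OF _ continuous_mult, of T "\<lambda>x. (x [^] n, x)"]
      by (simp add: comp_def)
  qed
  from openin_continuous_map_preimage[OF this V] show ?thesis
    by (simp add: topspace_eq)
qed

text \<open>If the powers of x with exponents 1, 2, 4, ..., 2^(m-1) all lie in the neighbourhood
  defining equicontinuity, then the successive squares of \<phi> x stay in T_+, and \<phi> x is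
  close to 1 at a rate independent of \<phi>.\<close>

lemma equicontinuous_chars_uniform:
  assumes S: "equicontinuous_chars G T S" and \<epsilon>: "\<epsilon> > 0"
  obtains W where "openin T W" "\<one> \<in> W" "\<And>\<phi> x. \<phi> \<in> S \<Longrightarrow> x \<in> W \<Longrightarrow> dist (\<phi> x) 1 < \<epsilon>"
proof -
  obtain U V where UV: "U \<subseteq> carrier G" "openin T V" "\<one> \<in> V" "V \<subseteq> U" "S \<subseteq> polar G T U"
    using S unfolding equicontinuous_chars_def by blast
  have "(\<lambda>m. 2 / sqrt 2 ^ m) \<longlonglongrightarrow> 0" by real_asymp
  then have "\<forall>\<^sub>F m in sequentially. 2 / sqrt 2 ^ m < \<epsilon>" using \<epsilon> by (rule order_tendstoD)
  then obtain m where m: "2 / sqrt 2 ^ m < \<epsilon>" by (auto dest: eventually_happens)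
  \<comment> \<open>Intersecting with \<open>topspace T\<close> keeps \<open>W\<close> inside the
    carrier also when m = 0.\<close>
  define W where "W = (\<Inter>j\<in>{..<m}. {x \<in> carrier G. x [^] ((2::nat) ^ j) \<in> V}) \<inter> topspace T"
  show thesis
  proof
    show "openin T W" unfolding W_def using openin_power_preimage[OF UV(2)] by (intro openin_INT) auto
    show "\<one> \<in> W" using UV(3) by (simp add: W_def topspace_eq)
    fix \<phi> x assume \<phi>: "\<phi> \<in> S" and x: "x \<in> W"
    have xc: "x \<in> carrier G" using x by (simp add: W_def topspace_eq)
    have \<phi>h: "\<phi> \<in> hom G circle_group"
      using \<phi> UV(5) by (intro continuous_chars_hom[of _ G T]) (auto simp: polar_def)
    have "dist (\<phi> x) 1 \<le> 2 / sqrt 2 ^ m"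
    proof (rule dist_one_le_of_powers_Re_nonneg)
      show "cmod (\<phi> x) = 1" by (rule circle_char_norm[OF \<phi>h xc])
      fix j assume "j < m"
      then have "x [^] ((2::nat) ^ j) \<in> U" using x UV(4) by (auto simp: W_def)
      then have "\<phi> (x [^] ((2::nat) ^ j)) \<in> circle_plus" using \<phi> UV(5) by (auto simp: polar_def)
      then show "0 \<le> Re (\<phi> x ^ 2 ^ j)" by (simp add: circle_plus_iff circle_char_pow[OF \<phi>h xc])
    qed
    then show "dist (\<phi> x) 1 < \<epsilon>" using m by simp
  qed
qed

text \<open>A finite union of compact sets is compact, so a single neighbourhood of the identity
  controls the whole finite family. Its translate by x works at x because |\<phi> y - \<phi> x| =
  |\<phi> (inv x y) - 1|.\<close>

lemma g_barrelled_imp_finer_than_tau_K: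
  assumes barrelled: "g_barrelled G T" and U: "openin (tau_K G T) U"
  shows "openin T U"
proof (subst openin_subopen, intro ballI)
  fix x assume x: "x \<in> U"
  have xc: "x \<in> carrier G"
    using x U unfolding tau_K_def openin_uniform_convergence_topology by blast
  obtain \<F> \<epsilon> where \<F>: "finite \<F>" "\<F> \<subseteq> {K. compactin (pointwise_topology G T) K}" "0 < \<epsilon>"
    "uniform_nbhd G \<F> \<epsilon> x \<subseteq> U"
    using U x unfolding tau_K_def openin_uniform_convergence_topology by blast
  have "compactin (pointwise_topology G T) (\<Union>\<F>)"
    using \<F>(1,2) by (intro compactin_Union) auto
  then have eq: "equicontinuous_chars G T (\<Union>\<F>)" and sub: "\<Union>\<F> \<subseteq> continuous_chars G T"
    using barrelled compact_subset_chars by (auto simp: g_barrelled_def)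
  obtain W where W: "openin T W" "\<one> \<in> W" "\<And>\<phi> x. \<phi> \<in> \<Union>\<F> \<Longrightarrow> x \<in> W \<Longrightarrow> dist (\<phi> x) 1 < \<epsilon>"
    using equicontinuous_chars_uniform[OF eq \<F>(3)] by blast
  let ?V = "{y \<in> carrier G. inv x \<otimes> y \<in> W}"
  have "?V \<subseteq> uniform_nbhd G \<F> \<epsilon> x"
  proof
    fix y assume y: "y \<in> ?V"
    have "dist (\<phi> y) (\<phi> x) < \<epsilon>" if "K \<in> \<F>" "\<phi> \<in> K" for K \<phi>
    proof -
      have \<phi>: "\<phi> \<in> hom G circle_group" using that sub continuous_chars_hom by blast
      have "y = x \<otimes> (inv x \<otimes> y)" using xc y by (simp add: m_assoc[symmetric])
      then have "\<phi> y = \<phi> x * \<phi> (inv x \<otimes> y)"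
        using xc y circle_char_mult[OF \<phi>, of x "inv x \<otimes> y"] by simp
      then have "dist (\<phi> y) (\<phi> x) = cmod (\<phi> x * (\<phi> (inv x \<otimes> y) - 1))"
        by (simp add: dist_norm algebra_simps)
      also have "\<dots> = dist (\<phi> (inv x \<otimes> y)) 1"
        by (simp add: norm_mult circle_char_norm[OF \<phi> xc] dist_norm)
      also have "\<dots> < \<epsilon>" using W(3) y that by blast
      finally show ?thesis .
    qed
    then show "y \<in> uniform_nbhd G \<F> \<epsilon> x" using y by (auto simp: uniform_nbhd_def)
  qed
  then show "\<exists>V. openin T V \<and> x \<in> V \<and> V \<subseteq> U"
    using openin_translate[OF W(1), of "inv x"] xc W(2) \<F>(4) by (intro exI[of _ ?V]) auto
qed

lemma g_barrelled_imp_chars_tau_K: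
  assumes "g_barrelled G T"
  shows "continuous_chars G (tau_K G T) = continuous_chars G T"
proof
  show "continuous_chars G (tau_K G T) \<subseteq> continuous_chars G T"
    using g_barrelled_imp_finer_than_tau_K[OF assms]
    by (auto simp: continuous_chars_def continuous_map_def topspace_eq tau_K_def)
qed (rule continuous_chars_subset_tau_K)

text \<open>Under compatibility the \<sigma>-compact sets for \<open>tau_K\<close> are exactly those
  whose uniform convergence defines it.\<close>

lemma g_barrelled_tau_K:
  assumes "continuous_chars G (tau_K G T) = continuous_chars G T"
  shows "g_barrelled G (tau_K G T)"
  unfolding g_barrelled_def pointwise_topology_eq_of_same_chars[OF assms]
proof (intro allI impI)
  fix S assume S: "compactin (pointwise_topology G T) S"
  \<comment> \<open>Radius 1 suffices: a circle point at distance less than 1 from 1 has positive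
    real part and so lies in T_+.\<close>
  obtain V where V: "openin (tau_K G T) V" "\<one> \<in> V" "V \<subseteq> uniform_nbhd G {S} 1 \<one>"
    unfolding tau_K_def
    by (rule uniform_nbhd_contains_open[of "{S}" "{K. compactin (pointwise_topology G T) K}" 1 "\<one>" G])
      (use S in auto)
  have "\<phi> \<in> polar G (tau_K G T) V" if \<phi>: "\<phi> \<in> S" for \<phi>
  proof -
    have \<phi>c: "\<phi> \<in> continuous_chars G T" using \<phi> compact_subset_chars[OF S] by blast
    have "\<phi> x \<in> circle_plus" if "x \<in> V" for x
    proof -
      have x: "x \<in> carrier G" "dist (\<phi> x) (\<phi> \<one>) < 1"
        using that V(3) \<phi> by (auto simp: uniform_nbhd_def)
      then have "cmod (1 - \<phi> x) < 1"
        by (simp add: circle_char_one[OF continuous_chars_hom[OF \<phi>c]] dist_norm norm_minus_commute)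
      then have "0 \<le> Re (\<phi> x)" using complex_Re_le_cmod[of "1 - \<phi> x"] by simp
      then show ?thesis
        by (simp add: circle_plus_iff circle_char_norm[OF continuous_chars_hom[OF \<phi>c] x(1)])
    qed
    then show ?thesis using \<phi>c assms by (simp add: polar_def)
  qed
  moreover have "V \<subseteq> carrier G" using V(3) by (auto simp: uniform_nbhd_def)
  ultimately show "equicontinuous_chars G (tau_K G T) S"
    using V(1,2) unfolding equicontinuous_chars_def by (intro exI[of _ V]) auto
qed

end


section \<open>The evaluation homeomorphism\<close>

lemma compact_open_subbasic:
  "\<lbrakk>compactin T K; openin circle_topology W\<rbrakk> \<Longrightarrow>
    openin (compact_open_topology G T) {\<phi> \<in> continuous_chars G T. \<phi> ` K \<subseteq> W}"
  unfolding compact_open_topology_def by (intro topology_generated_by_Basis) blast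

context abelian_topological_group
begin

abbreviation "bidual_chars \<equiv> continuous_chars (dual_group G T) (pointwise_topology G T)"
abbreviation "bidual_topology \<equiv> compact_open_topology (dual_group G T) (pointwise_topology G T)"

lemma eval_char_mult:
  assumes "x \<in> carrier G" "y \<in> carrier G"
  shows "eval_char G T (x \<otimes> y) =
    eval_char G T x \<otimes>\<^bsub>dual_group (dual_group G T) (pointwise_topology G T)\<^esub> eval_char G T y"
  using assms by (auto simp: eval_char_def fun_eq_iff circle_char_mult[OF continuous_chars_hom])

text \<open>For fixed x the values \<phi> x with \<phi> in \<open>K\<close> form a compact set,
  being the image of \<open>K\<close> under evaluation at x. Inside an open set this leaves a
  positive margin, which serves as one radius for all \<phi> in \<open>K\<close>.\<close>

lemma continuous_map_eval_char: "continuous_map (tau_K G T) bidual_topology (eval_char G T)"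
  unfolding compact_open_topology_def
proof (rule continuous_on_generated_topo)
  fix B assume "B \<in> {{\<phi> \<in> bidual_chars. \<phi> ` K \<subseteq> W} |K W.
      compactin (pointwise_topology G T) K \<and> openin circle_topology W}"
  then obtain K W where K: "compactin (pointwise_topology G T) K" and W: "openin circle_topology W"
    and B: "B = {\<phi> \<in> bidual_chars. \<phi> ` K \<subseteq> W}" by blast
  have sub: "K \<subseteq> continuous_chars G T" by (rule compact_subset_chars[OF K])
  have preimage: "eval_char G T -` B \<inter> topspace (tau_K G T) = {x \<in> carrier G. \<forall>\<phi>\<in>K. \<phi> x \<in> W}"
    using sub eval_char_continuous_char by (auto simp: B tau_K_def eval_char_apply subset_iff)
  have "openin (tau_K G T) {x \<in> carrier G. \<forall>\<phi>\<in>K. \<phi> x \<in> W}"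
    unfolding tau_K_def openin_uniform_convergence_topology
  proof (intro conjI ballI)
    fix x assume x: "x \<in> {x \<in> carrier G. \<forall>\<phi>\<in>K. \<phi> x \<in> W}"
    then have xc: "x \<in> carrier G" by simp
    obtain W' where W': "open W'" "W = W' \<inter> sphere 0 1"
      using W by (auto simp: circle_topology_def openin_subtopology)
    have "compactin circle_topology (eval_char G T x ` K)"
      using K continuous_chars_continuous[OF eval_char_continuous_char[OF xc]] by (rule image_compactin)
    then have "compact (eval_char G T x ` K)"
      by (simp add: circle_topology_def compactin_subtopology)
    moreover have "eval_char G T x ` K \<subseteq> W'"
      using x sub W'(2) by (auto simp: eval_char_apply subset_iff)
    ultimately obtain e where e: "e > 0" "(\<Union>z\<in>eval_char G T x ` K. ball z e) \<subseteq> W'"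
      using compact_subset_open_imp_ball_epsilon_subset[OF _ W'(1)] by blast
    have "\<phi> y \<in> W" if y: "y \<in> uniform_nbhd G {K} e x" and \<phi>: "\<phi> \<in> K" for y \<phi>
    proof -
      have "y \<in> carrier G" "dist (\<phi> y) (\<phi> x) < e" using y \<phi> by (auto simp: uniform_nbhd_def)
      moreover have "eval_char G T x \<phi> = \<phi> x" using \<phi> sub by (auto simp: eval_char_apply)
      ultimately have "\<phi> y \<in> W'" using e(2) \<phi> by (force simp: dist_commute)
      moreover have "\<phi> y \<in> sphere 0 1"
        using \<open>y \<in> carrier G\<close> \<phi> sub by (intro circle_char_closed[OF continuous_chars_hom]) auto
      ultimately show ?thesis using W'(2) by blast
    qed
    then show "\<exists>\<F> \<epsilon>. finite \<F> \<and> \<F> \<subseteq> {K. compactin (pointwise_topology G T) K} \<and> 0 < \<epsilon> \<and>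
        uniform_nbhd G \<F> \<epsilon> x \<subseteq> {x \<in> carrier G. \<forall>\<phi>\<in>K. \<phi> x \<in> W}"
      using K e(1) by (intro exI[of _ "{K}"] exI[of _ e]) (auto simp: uniform_nbhd_def)
  qed auto
  then show "openin (tau_K G T) (eval_char G T -` B \<inter> topspace (tau_K G T))"
    by (simp only: preimage)
next
  show "eval_char G T ` topspace (tau_K G T) \<subseteq>
      \<Union>{{\<phi> \<in> bidual_chars. \<phi> ` K \<subseteq> W} |K W.
        compactin (pointwise_topology G T) K \<and> openin circle_topology W}"
  proof -
    have "bidual_chars \<in> {{\<phi> \<in> bidual_chars. \<phi> ` K \<subseteq> W} |K W.
        compactin (pointwise_topology G T) K \<and> openin circle_topology W}"
      by (intro CollectI exI[of _ "{}"]) auto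
    then show ?thesis using eval_char_continuous_char by (auto simp: tau_K_def)
  qed
qed

text \<open>
  Cutting a compact set of characters into finitely many compact pieces on which the value at \<open>x\<close>
  hardly varies turns uniform closeness to \<open>x\<close> into finitely many compact-open conditions.
\<close>

lemma eval_char_uniform_nbhd:
  assumes K: "compactin (pointwise_topology G T) K" and x: "x \<in> carrier G" and \<epsilon>: "\<epsilon> > 0"
  obtains N where "openin bidual_topology N" "eval_char G T x \<in> N"
    "\<And>y \<phi>. y \<in> carrier G \<Longrightarrow> eval_char G T y \<in> N \<Longrightarrow> \<phi> \<in> K \<Longrightarrow> dist (\<phi> y) (\<phi> x) < \<epsilon>"
proof -
  have "compact (sphere (0::complex) 1)" by simp
  then obtain Z where Z: "finite Z" "sphere (0::complex) 1 \<subseteq> (\<Union>z\<in>Z. ball z (\<epsilon> / 3))"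
    using seq_compact_imp_totally_bounded[of "sphere (0::complex) 1"] \<epsilon>
    by (metis compact_imp_seq_compact divide_pos_pos zero_less_numeral)
  \<comment> \<open>Closed balls keep the pieces compact; the larger open balls of radius
    \<epsilon>/2 used in \<open>N\<close> contain their values at x, and \<epsilon>/3 + \<epsilon>/2
    < \<epsilon>.\<close>
  define P where "P z = {\<phi> \<in> continuous_chars G T. \<phi> x \<in> cball z (\<epsilon> / 3) \<inter> sphere 0 1} \<inter> K" for z
  have P: "compactin (pointwise_topology G T) (P z)" for z
    unfolding P_def
  proof (rule closed_Int_compactin[OF _ K])
    have "closedin circle_topology (cball z (\<epsilon> / 3) \<inter> sphere 0 1)"
      unfolding circle_topology_def by (intro closedin_closed_Int[of _ "sphere 0 1", simplified Int_commute]) auto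
    then have "closedin (pointwise_topology G T)
        {\<phi> \<in> topspace (pointwise_topology G T). eval_char G T x \<phi> \<in> cball z (\<epsilon> / 3) \<inter> sphere 0 1}"
      by (rule closedin_continuous_map_preimage[OF continuous_chars_continuous[OF eval_char_continuous_char[OF x]]])
    moreover have "{\<phi> \<in> topspace (pointwise_topology G T). eval_char G T x \<phi> \<in> cball z (\<epsilon> / 3) \<inter> sphere 0 1} =
        {\<phi> \<in> continuous_chars G T. \<phi> x \<in> cball z (\<epsilon> / 3) \<inter> sphere 0 1}"
      by (auto simp: eval_char_apply)
    ultimately show "closedin (pointwise_topology G T)
        {\<phi> \<in> continuous_chars G T. \<phi> x \<in> cball z (\<epsilon> / 3) \<inter> sphere 0 1}" by simp
  qed
  have P_sub: "P z \<subseteq> continuous_chars G T" for z by (auto simp: P_def)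
  define N where "N = (\<Inter>z\<in>Z. {\<psi> \<in> bidual_chars. \<psi> ` P z \<subseteq> ball z (\<epsilon> / 2) \<inter> sphere 0 1}) \<inter>
    topspace bidual_topology"
  show thesis
  proof
    show "openin bidual_topology N"
      unfolding N_def by (intro openin_INT Z(1) compact_open_subbasic P openin_circle_ball)
    have "eval_char G T x \<phi> \<in> ball z (\<epsilon> / 2) \<inter> sphere 0 1" if "\<phi> \<in> P z" for z \<phi>
      using that \<epsilon> P_sub[of z] by (auto simp: P_def eval_char_apply)
    then show "eval_char G T x \<in> N"
      using eval_char_continuous_char[OF x] by (auto simp: N_def)
    fix y \<phi> assume y: "y \<in> carrier G" "eval_char G T y \<in> N" and \<phi>: "\<phi> \<in> K"
    have \<phi>c: "\<phi> \<in> continuous_chars G T" using \<phi> compact_subset_chars[OF K] by blast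
    have s: "\<phi> x \<in> sphere 0 1" by (rule circle_char_closed[OF continuous_chars_hom[OF \<phi>c] x])
    then obtain z where z: "z \<in> Z" "\<phi> x \<in> ball z (\<epsilon> / 3)" using Z(2) by blast
    then have "\<phi> \<in> P z" using \<phi> \<phi>c s by (auto simp: P_def)
    moreover have "eval_char G T y ` P z \<subseteq> ball z (\<epsilon> / 2)" using y(2) z(1) by (auto simp: N_def)
    ultimately have "\<phi> y \<in> ball z (\<epsilon> / 2)" using \<phi>c by (force simp: eval_char_apply)
    then show "dist (\<phi> y) (\<phi> x) < \<epsilon>"
      using z(2) \<epsilon> dist_triangle[of "\<phi> y" "\<phi> x" z] by (simp add: dist_commute)
  qed
qed

text \<open>The image must be open in the whole bidual, not merely in the range of evaluation. Here
  Comfort-Ross enters: every point of the open set \<open>N\<close> is itself an evaluation.\<close>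

lemma openin_eval_char_image:
  assumes U: "openin (tau_K G T) U"
  shows "openin bidual_topology (eval_char G T ` U)"
proof (subst openin_subopen, intro ballI)
  fix \<psi> assume "\<psi> \<in> eval_char G T ` U"
  then obtain x where x: "x \<in> U" "\<psi> = eval_char G T x" by blast
  have xc: "x \<in> carrier G"
    using x U unfolding tau_K_def openin_uniform_convergence_topology by blast
  obtain \<F> \<epsilon> where \<F>: "finite \<F>" "\<F> \<subseteq> {K. compactin (pointwise_topology G T) K}" "0 < \<epsilon>"
    "uniform_nbhd G \<F> \<epsilon> x \<subseteq> U"
    using U x unfolding tau_K_def openin_uniform_convergence_topology by blast
  have K: "compactin (pointwise_topology G T) (\<Union>\<F>)"
    using \<F>(1,2) by (intro compactin_Union) auto
  obtain N where N: "openin bidual_topology N" "eval_char G T x \<in> N"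
    "\<And>y \<phi>. y \<in> carrier G \<Longrightarrow> eval_char G T y \<in> N \<Longrightarrow> \<phi> \<in> \<Union>\<F> \<Longrightarrow> dist (\<phi> y) (\<phi> x) < \<epsilon>"
    using eval_char_uniform_nbhd[OF K xc \<F>(3)] by blast
  have "N \<subseteq> eval_char G T ` U"
  proof
    fix \<psi> assume \<psi>: "\<psi> \<in> N"
    then have "\<psi> \<in> bidual_chars" using openin_subset[OF N(1)] by auto
    then obtain y where y: "y \<in> carrier G" "\<psi> = eval_char G T y"
      unfolding continuous_chars_pointwise_dual by blast
    then have "y \<in> uniform_nbhd G \<F> \<epsilon> x" using N(3) \<psi> by (auto simp: uniform_nbhd_def)
    then show "\<psi> \<in> eval_char G T ` U" using \<F>(4) y(2) by blast
  qed
  then show "\<exists>N. openin bidual_topology N \<and> \<psi> \<in> N \<and> N \<subseteq> eval_char G T ` U"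
    using N(1,2) x(2) by blast
qed

text \<open>Separation of points enters here. It permits a character of G to be read as a function
  on the bidual.\<close>

lemma inj_on_eval_char:
  assumes "separates_points G (continuous_chars G T)"
  shows "inj_on (eval_char G T) (carrier G)"
proof (rule inj_onI, rule ccontr)
  fix x y assume xy: "x \<in> carrier G" "y \<in> carrier G" "eval_char G T x = eval_char G T y" "x \<noteq> y"
  then obtain \<phi> where \<phi>: "\<phi> \<in> continuous_chars G T" "\<phi> x \<noteq> \<phi> y"
    using assms unfolding separates_points_def by blast
  then show False using xy(3) eval_char_apply[OF \<phi>(1)] by metis
qed

section \<open>Continuous characters of the bidual and semireflexivity\<close>

abbreviation "bidual_eval \<equiv> eval_char (dual_group G T) (pointwise_topology G T)"

lemma bidual_eval_apply:
  assumes "x \<in> carrier G" "\<phi> \<in> continuous_chars G T"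
  shows "bidual_eval \<phi> (eval_char G T x) = \<phi> x"
  using assms by (simp add: eval_char_apply[OF eval_char_continuous_char] eval_char_apply)

text \<open>This is the inclusion in semireflexivity that always holds: as the singleton of \<phi>
  is compact, preimages of open sets under evaluation at \<phi> are subbasic.\<close>

lemma bidual_eval_continuous_char:
  assumes \<phi>: "\<phi> \<in> continuous_chars G T"
  shows "bidual_eval \<phi> \<in> continuous_chars
    (dual_group (dual_group G T) (pointwise_topology G T)) bidual_topology"
proof -
  have cpt: "compactin (pointwise_topology G T) {\<phi>}"
    using \<phi> by (intro finite_imp_compactin) auto
  have closed: "\<psi> \<phi> \<in> sphere 0 1" if "\<psi> \<in> bidual_chars" for \<psi>
    using circle_char_closed[OF continuous_chars_hom[OF that]] \<phi> by simp
  have "continuous_map bidual_topology circle_topology (bidual_eval \<phi>)"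
    unfolding continuous_map_def
  proof (intro conjI allI impI)
    fix W assume "openin circle_topology W"
    from compact_open_subbasic[OF cpt this, of "dual_group G T"]
    show "openin bidual_topology {\<psi> \<in> topspace bidual_topology. bidual_eval \<phi> \<psi> \<in> W}"
      by (simp add: eval_char_apply cong: conj_cong)
  qed (use closed in \<open>auto simp: eval_char_apply\<close>)
  moreover have "bidual_eval \<phi> \<in> hom (dual_group (dual_group G T) (pointwise_topology G T)) circle_group"
  proof (rule homI)
    fix \<psi> \<psi>' assume *: "\<psi> \<in> carrier (dual_group (dual_group G T) (pointwise_topology G T))"
      "\<psi>' \<in> carrier (dual_group (dual_group G T) (pointwise_topology G T))"
    then obtain x y where xy: "x \<in> carrier G" "\<psi> = eval_char G T x" "y \<in> carrier G" "\<psi>' = eval_char G T y"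
      unfolding dual_group_simps continuous_chars_pointwise_dual by blast
    show "bidual_eval \<phi> (\<psi> \<otimes>\<^bsub>dual_group (dual_group G T) (pointwise_topology G T)\<^esub> \<psi>') =
        bidual_eval \<phi> \<psi> \<otimes>\<^bsub>circle_group\<^esub> bidual_eval \<phi> \<psi>'"
      unfolding xy(2,4) eval_char_mult[OF xy(1,3), symmetric]
      using xy(1,3) \<phi>
      by (simp add: bidual_eval_apply circle_char_mult[OF continuous_chars_hom] circle_group_def)
  qed (use closed in \<open>auto simp: eval_char_apply circle_group_def\<close>)
  ultimately show ?thesis by (simp add: continuous_chars_def eval_char_def)
qed

text \<open>Both directions transport characters along evaluation: openness of images carries a
  \<open>tau_K\<close>-character to the bidual, and continuity pulls a bidual character back to G.
  Under this correspondence evaluation at \<phi> matches \<phi> itself.\<close>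

lemma semireflexive_iff_tau_K_compatible:
  assumes sep: "separates_points G (continuous_chars G T)"
  shows "semireflexive (dual_group G T) (pointwise_topology G T) \<longleftrightarrow>
    continuous_chars G (tau_K G T) = continuous_chars G T"
proof
  let ?D = "dual_group (dual_group G T) (pointwise_topology G T)"
  assume "semireflexive (dual_group G T) (pointwise_topology G T)"
  then have refl: "continuous_chars ?D bidual_topology = bidual_eval ` continuous_chars G T"
    by (simp add: semireflexive_def)
  have "\<phi> \<in> continuous_chars G T" if \<phi>: "\<phi> \<in> continuous_chars G (tau_K G T)" for \<phi>
  proof -
    define e' where "e' = inv_into (carrier G) (eval_char G T)"
    define \<Phi> where "\<Phi> = (\<lambda>\<psi>\<in>bidual_chars. \<phi> (e' \<psi>))"
    have e': "e' (eval_char G T x) = x" if "x \<in> carrier G" for x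
      unfolding e'_def using inj_on_eval_char[OF sep] that by (rule inv_into_f_f)
    have \<Phi>: "\<Phi> (eval_char G T x) = \<phi> x" if "x \<in> carrier G" for x
      using that by (simp add: \<Phi>_def eval_char_continuous_char e')
    note \<phi>_hom = continuous_chars_hom[OF \<phi>]
    have "continuous_map bidual_topology circle_topology \<Phi>"
      unfolding continuous_map_def
    proof (intro conjI allI impI)
      show "\<Phi> \<in> topspace bidual_topology \<rightarrow> topspace circle_topology"
        using circle_char_closed[OF \<phi>_hom] by (auto simp: continuous_chars_pointwise_dual \<Phi>)
      fix W assume W: "openin circle_topology W"
      have "openin (tau_K G T) {x \<in> carrier G. \<phi> x \<in> W}"
        using openin_continuous_map_preimage[OF continuous_chars_continuous[OF \<phi>] W]
        by (simp add: tau_K_def)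
      from openin_eval_char_image[OF this]
      show "openin bidual_topology {\<psi> \<in> topspace bidual_topology. \<Phi> \<psi> \<in> W}"
      proof (rule back_subst[of "openin bidual_topology"])
        show "eval_char G T ` {x \<in> carrier G. \<phi> x \<in> W} =
            {\<psi> \<in> topspace bidual_topology. \<Phi> \<psi> \<in> W}"
          by (auto simp: continuous_chars_pointwise_dual \<Phi>)
      qed
    qed
    moreover have "\<Phi> \<in> hom ?D circle_group"
    proof (rule homI)
      show "\<Phi> \<psi> \<in> carrier circle_group" if "\<psi> \<in> carrier ?D" for \<psi>
        using that circle_char_closed[OF \<phi>_hom]
        by (auto simp: continuous_chars_pointwise_dual \<Phi> circle_group_def)
      fix \<psi> \<psi>' assume "\<psi> \<in> carrier ?D" "\<psi>' \<in> carrier ?D"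
      then obtain x y where xy: "x \<in> carrier G" "\<psi> = eval_char G T x" "y \<in> carrier G" "\<psi>' = eval_char G T y"
        unfolding dual_group_simps continuous_chars_pointwise_dual by blast
      show "\<Phi> (\<psi> \<otimes>\<^bsub>?D\<^esub> \<psi>') = \<Phi> \<psi> \<otimes>\<^bsub>circle_group\<^esub> \<Phi> \<psi>'"
        unfolding xy(2,4) eval_char_mult[OF xy(1,3), symmetric]
        using xy(1,3) by (simp add: \<Phi> circle_char_mult[OF \<phi>_hom] circle_group_def)
    qed
    ultimately have "\<Phi> \<in> continuous_chars ?D bidual_topology"
      by (simp add: continuous_chars_def \<Phi>_def)
    then obtain \<phi>' where \<phi>': "\<phi>' \<in> continuous_chars G T" "\<Phi> = bidual_eval \<phi>'"
      unfolding refl by blast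
    have "\<phi> = \<phi>'"
    proof (rule extensionalityI)
      show "\<phi> x = \<phi>' x" if "x \<in> carrier G" for x
        using \<Phi>[OF that] bidual_eval_apply[OF that \<phi>'(1)] by (simp add: \<phi>'(2))
    qed (use \<phi> \<phi>'(1) continuous_chars_extensional in auto)
    then show ?thesis using \<phi>'(1) by simp
  qed
  then show "continuous_chars G (tau_K G T) = continuous_chars G T"
    using continuous_chars_subset_tau_K by blast
next
  let ?D = "dual_group (dual_group G T) (pointwise_topology G T)"
  assume compatible: "continuous_chars G (tau_K G T) = continuous_chars G T"
  have "\<Phi> \<in> bidual_eval ` continuous_chars G T" if \<Phi>: "\<Phi> \<in> continuous_chars ?D bidual_topology" for \<Phi>
  proof -
    define \<phi> where "\<phi> = (\<lambda>x\<in>carrier G. \<Phi> (eval_char G T x))"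
    note \<Phi>_hom = continuous_chars_hom[OF \<Phi>]
    have "\<phi> \<in> hom G circle_group"
    proof (rule homI)
      show "\<phi> x \<in> carrier circle_group" if "x \<in> carrier G" for x
        using circle_char_closed[OF \<Phi>_hom, of "eval_char G T x"] that
        by (simp add: \<phi>_def eval_char_continuous_char circle_group_def)
      show "\<phi> (x \<otimes> y) = \<phi> x \<otimes>\<^bsub>circle_group\<^esub> \<phi> y" if "x \<in> carrier G" "y \<in> carrier G" for x y
        using circle_char_mult[OF \<Phi>_hom, of "eval_char G T x" "eval_char G T y"] that
          eval_char_mult[OF that]
        by (simp add: \<phi>_def eval_char_continuous_char circle_group_def del: dual_group_simps(2))
    qed
    moreover have "continuous_map (tau_K G T) circle_topology \<phi>"
      by (rule continuous_map_eq[OF continuous_map_compose[OF continuous_map_eval_char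
            continuous_chars_continuous[OF \<Phi>]]]) (simp add: tau_K_def \<phi>_def)
    ultimately have \<phi>: "\<phi> \<in> continuous_chars G T"
      unfolding compatible[symmetric] by (simp add: continuous_chars_def \<phi>_def)
    have "\<Phi> = bidual_eval \<phi>"
    proof (rule extensionalityI)
      show "\<Phi> \<in> extensional bidual_chars" using continuous_chars_extensional[OF \<Phi>] by simp
      show "bidual_eval \<phi> \<in> extensional bidual_chars" by (simp add: eval_char_def)
      fix \<psi> assume "\<psi> \<in> bidual_chars"
      then obtain x where "x \<in> carrier G" "\<psi> = eval_char G T x"
        unfolding continuous_chars_pointwise_dual by blast
      then show "\<Phi> \<psi> = bidual_eval \<phi> \<psi>" using \<phi> by (simp add: bidual_eval_apply \<phi>_def)
    qed
    then show ?thesis using \<phi> by blast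
  qed
  then show "semireflexive (dual_group G T) (pointwise_topology G T)"
    using bidual_eval_continuous_char by (auto simp: semireflexive_def)
qed

end

theorem theorem4p6:
  fixes G :: "('a, 'b) monoid_scheme" and \<tau> :: "'a topology"
  assumes "abelian_topological_group G \<tau>"
    and "separates_points G (continuous_chars G \<tau>)"
  shows "((\<exists>\<mu>. abelian_topological_group G \<mu> \<and> g_barrelled G \<mu> \<and>
             continuous_chars G \<mu> = continuous_chars G \<tau>)
          \<longleftrightarrow> semireflexive (dual_group G \<tau>) (pointwise_topology G \<tau>))
       \<and> (semireflexive (dual_group G \<tau>) (pointwise_topology G \<tau>)
          \<longleftrightarrow> continuous_chars G (tau_K G \<tau>) = continuous_chars G \<tau>)"
proof -
  interpret abelian_topological_group G \<tau> by fact
  \<comment> \<open>The result for g-barrelled groups is applied to \<mu> and speaks of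
    \<open>tau_K G \<mu>\<close>; equality of the characters identifies this with
    \<open>tau_K G \<tau>\<close>.\<close>
  have "continuous_chars G (tau_K G \<tau>) = continuous_chars G \<tau>"
    if "abelian_topological_group G \<mu>" "g_barrelled G \<mu>"
      "continuous_chars G \<mu> = continuous_chars G \<tau>" for \<mu>
    using abelian_topological_group.g_barrelled_imp_chars_tau_K[OF that(1,2)]
      pointwise_topology_eq_of_same_chars[OF that(3)] that(3)
    by (simp add: tau_K_def)
  then show ?thesis
    using semireflexive_iff_tau_K_compatible[OF assms(2)]
      abelian_topological_group_tau_K g_barrelled_tau_K by blast
qed

end
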